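(* Let $M$ be a semi-invariant submanifold of a normal complex contact metric manifold $\bar M$, with anti-invariant distribution $\mathcal D^{\bot}$. Then $\mathcal D^{\bot}$ is involutive, i.e. $[K,L]\in\Gamma(\mathcal D^{\bot})$ for all $K,L\in\Gamma(\mathcal D^{\bot})$.
   Context: Complex contact metric manifolds. A complex contact manifold is a complex manifold $\bar M$ of complex dimension $2m+1$ with an open cover by coordinate neighborhoods $\mathcal U_i$ and holomorphic $1$-forms $\omega_i$ on $\mathcal U_i$ with $\omega_i\wedge(d\omega_i)^m\neq 0$ on $\mathcal U_i$ and $\omega_i=f_{ij}\omega_j$ on $\mathcal U_i\cap\mathcal U_j\ne\emptyset$ with $f_{ij}$ holomorphic. The kernels of the $\omega_i$ define the horizontal subbundle $\mathcal H\subset T\bar M$. Let $\bar J$ be the complex structure and $\bar g$ a Hermitian metric. A complex almost contact metric structure consists, on each $\mathcal U_i$ (index suppressed), of real $1$-forms $\bar u$, $\bar v=\bar u\circ \bar J$, with dual unit vector fields $\bar U$, $\bar V=-\bar J\bar U$, and $(1,1)$-tensor fields $\bar G$, $\bar H=\bar G\bar J$ such that $\bar G^2=\bar H^2=-I+\bar u\otimes\bar U+\bar v\otimes\bar V$, $\bar G\bar J=-\bar J\bar G$, $\bar G\bar U=0$, $\bar g(K,\bar GL)=-\bar g(\bar GK,L)$; on overlaps $u_j=cu_i-dv_i$, $v_j=du_i+cv_i$, $G_j=cG_i-dH_i$, $H_j=dG_i+cH_i$ for functions $c,d$ with $c^2+d^2=1$. Let $\bar\nabla$ be the Levi-Civita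 connection of $\bar g$ and $\bar\sigma(K)=\bar g(\bar\nabla_K\bar U,\bar V)$. $\bar M$ is a complex contact metric manifold if moreover $\mathcal H=\ker\bar u\cap\ker\bar v$ and $d\bar u(K,L)=\bar g(K,\bar GL)+(\bar\sigma\wedge\bar v)(K,L)$, $d\bar v(K,L)=\bar g(K,\bar HL)-(\bar\sigma\wedge\bar u)(K,L)$ (conventions $2d\alpha(K,L)=K\alpha(L)-L\alpha(K)-\alpha([K,L])$ and $2(\alpha\wedge\beta)(K,L)=\alpha(K)\beta(L)-\alpha(L)\beta(K)$). Normality (Korkmaz). For a $(1,1)$-tensor $F$ put $[F,F](K,L)=(\bar\nabla_{FK}F)L-(\bar\nabla_{FL}F)K-F(\bar\nabla_KF)L+F(\bar\nabla_LF)K$. Define $S(K,L)=[\bar G,\bar G](K,L)+2\bar g(K,\bar GL)\bar U-2\bar g(K,\bar HL)\bar V+2(\bar v(L)\bar HK-\bar v(K)\bar HL)+\bar\sigma(\bar GL)\bar HK-\bar\sigma(\bar GK)\bar HL+\bar\sigma(K)\bar G\bar HL-\bar\sigma(L)\bar G\bar HK$, $T(K,L)=[\bar H,\bar H](K,L)-2\bar g(K,\bar GL)\bar U+2\bar g(K,\bar HL)\bar V+2(\bar u(L)\bar GK-\bar u(K)\bar GL)+\bar\sigma(\bar HK)\bar GL-\bar\sigma(\bar HL)\bar GK+\bar\sigma(K)\bar G\bar HL-\bar\sigma(L)\bar G\bar HK$. $\bar M$ is normal if $S(K,L)=T(K,L)=0$ for all $K,L\in\mathcal H$ and $S(K,\bar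 U)=T(K,\bar V)=0$ for all $K$. Semi-invariant submanifolds. Let $M$ be a complex submanifold of the normal complex contact metric manifold $\bar M$ (real dimension $4m+2$), of real dimension $n+2$, with $\bar U,\bar V$ tangent to $M$. $M$ is semi-invariant if there are smooth distributions $\mathcal D,\mathcal D^{\bot}$ on $M$, orthogonal to $sp\{\bar U,\bar V\}$ (the span of $\bar U,\bar V$), with $TM=\mathcal D\oplus\mathcal D^{\bot}\oplus sp\{\bar U,\bar V\}$ (orthogonal sum), $\bar G\mathcal D=\mathcal D$, $\bar H\mathcal D=\mathcal D$, $\bar G\mathcal D^{\bot}\subset TM^{\bot}$, $\bar H\mathcal D^{\bot}\subset TM^{\bot}$, where $TM^\bot$ is the normal bundle. $\mathcal D$ is called the invariant and $\mathcal D^{\bot}$ the anti-invariant distribution. *)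

theory Defs
  imports "HOL-Analysis.Analysis"
begin

section \<open>Smooth and holomorphic maps between open subsets of Euclidean spaces\<close>

primrec Ck_on :: "nat \<Rightarrow> 'a::real_normed_vector set \<Rightarrow> ('a \<Rightarrow> 'b::real_normed_vector) \<Rightarrow> bool" where
  "Ck_on 0 S f \<longleftrightarrow> continuous_on S f"
| "Ck_on (Suc k) S f \<longleftrightarrow>
     (\<forall>x\<in>S. f differentiable (at x)) \<and> (\<forall>v. Ck_on k S (\<lambda>x. frechet_derivative f (at x) v))"

definition smooth_on :: "'a::real_normed_vector set \<Rightarrow> ('a \<Rightarrow> 'b::real_normed_vector) \<Rightarrow> bool" where
  "smooth_on S f \<longleftrightarrow> (\<forall>k. Ck_on k S f)"

text \<open>Holomorphic in several variables: smooth with complex-linear derivative (Cauchy--Riemann).\<close>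

definition hol_on :: "(complex ^ 'n) set \<Rightarrow> (complex ^ 'n \<Rightarrow> complex) \<Rightarrow> bool" where
  "hol_on S f \<longleftrightarrow> smooth_on S f \<and>
     (\<forall>x\<in>S. \<forall>v. frechet_derivative f (at x) (\<i> *s v) = \<i> * frechet_derivative f (at x) v)"

definition hol_map_on :: "(complex ^ 'n) set \<Rightarrow> (complex ^ 'n \<Rightarrow> complex ^ 'k) \<Rightarrow> bool" where
  "hol_map_on S f \<longleftrightarrow> smooth_on S f \<and>
     (\<forall>x\<in>S. \<forall>v. frechet_derivative f (at x) (\<i> *s v) = \<i> *s frechet_derivative f (at x) v)"


section \<open>Complex manifolds\<close>

text \<open>The underlying set of a manifold is a whole type; a chart is a pair of a domain and a
  coordinate map, and a complex manifold is given by a holomorphic atlas (not necessarily maximal).\<close>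

type_synonym ('p, 'n) chart = "'p set \<times> ('p \<Rightarrow> complex ^ 'n)"

abbreviation chart_inv :: "('p, 'n) chart \<Rightarrow> complex ^ 'n \<Rightarrow> 'p" where
  "chart_inv c \<equiv> inv_into (fst c) (snd c)"

definition complex_atlas :: "('p::topological_space, 'n::finite) chart set \<Rightarrow> bool" where
  "complex_atlas A \<longleftrightarrow>
     (\<Union>c\<in>A. fst c) = UNIV \<and>
     (\<forall>c\<in>A. open (fst c) \<and> open (snd c ` fst c) \<and>
        homeomorphism (fst c) (snd c ` fst c) (snd c) (chart_inv c)) \<and>
     (\<forall>b\<in>A. \<forall>c\<in>A. hol_map_on (snd b ` (fst b \<inter> fst c)) (snd c \<circ> chart_inv b))"

text \<open>Domains of charts of the maximal atlas.\<close>

definition coordinate_nbhd :: "('p::topological_space, 'n::finite) chart set \<Rightarrow> 'p set \<Rightarrow> bool" where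
  "coordinate_nbhd A W \<longleftrightarrow> (\<exists>\<phi>. complex_atlas (insert (W, \<phi>) A))"

definition chart_at :: "('p, 'n) chart set \<Rightarrow> 'p \<Rightarrow> ('p, 'n) chart" where
  "chart_at A p = (SOME c. c \<in> A \<and> p \<in> fst c)"

text \<open>The tangent space at \<open>p\<close> is the model space \<open>complex ^ 'n\<close>: a tangent vector at \<open>p\<close> is
  represented by its components in the chosen chart \<open>chart_at A p\<close>. Hence vector fields are
  functions \<open>'p \<Rightarrow> complex ^ 'n\<close>, (1,1)-tensor fields are functions
  \<open>'p \<Rightarrow> complex ^ 'n \<Rightarrow> complex ^ 'n\<close>, and so on. \<open>coord A c p\<close> converts a tangent vector at \<open>p\<close>
  to its components in the chart \<open>c\<close>. As coordinate changes are holomorphic, the complex structure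
  is multiplication by \<open>\<i>\<close> in every chart.\<close>

definition coord :: "('p, 'n::finite) chart set \<Rightarrow> ('p, 'n) chart \<Rightarrow> 'p \<Rightarrow> complex ^ 'n \<Rightarrow> complex ^ 'n" where
  "coord A c p = frechet_derivative (snd c \<circ> chart_inv (chart_at A p)) (at (snd (chart_at A p) p))"

definition J :: "complex ^ 'n \<Rightarrow> complex ^ 'n" where
  "J x = \<i> *s x"

definition vf_rep :: "('p, 'n::finite) chart set \<Rightarrow> ('p, 'n) chart \<Rightarrow> ('p \<Rightarrow> complex ^ 'n)
    \<Rightarrow> complex ^ 'n \<Rightarrow> complex ^ 'n" where
  "vf_rep A c X = (\<lambda>x. coord A c (chart_inv c x) (X (chart_inv c x)))"

text \<open>In all notions below, \<open>W\<close> is meant to be an open set, and fields and functions defined only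
  on \<open>W\<close> are total functions whose values outside \<open>W\<close> are irrelevant.\<close>

definition smooth_fun :: "('p, 'n::finite) chart set \<Rightarrow> 'p set \<Rightarrow> ('p \<Rightarrow> 'b::real_normed_vector) \<Rightarrow> bool" where
  "smooth_fun A W f \<longleftrightarrow> (\<forall>c\<in>A. smooth_on (snd c ` (fst c \<inter> W)) (f \<circ> chart_inv c))"

definition hol_fun :: "('p, 'n::finite) chart set \<Rightarrow> 'p set \<Rightarrow> ('p \<Rightarrow> complex) \<Rightarrow> bool" where
  "hol_fun A W f \<longleftrightarrow> (\<forall>c\<in>A. hol_on (snd c ` (fst c \<inter> W)) (f \<circ> chart_inv c))"

definition smooth_vf :: "('p, 'n::finite) chart set \<Rightarrow> 'p set \<Rightarrow> ('p \<Rightarrow> complex ^ 'n) \<Rightarrow> bool" where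
  "smooth_vf A W X \<longleftrightarrow> (\<forall>c\<in>A. smooth_on (snd c ` (fst c \<inter> W)) (vf_rep A c X))"

definition hol_vf :: "('p, 'n::finite) chart set \<Rightarrow> 'p set \<Rightarrow> ('p \<Rightarrow> complex ^ 'n) \<Rightarrow> bool" where
  "hol_vf A W X \<longleftrightarrow> (\<forall>c\<in>A. hol_map_on (snd c ` (fst c \<inter> W)) (vf_rep A c X))"

text \<open>Derivative of a function at \<open>p\<close> along a tangent vector at \<open>p\<close>.\<close>

definition dir_deriv :: "('p, 'n::finite) chart set \<Rightarrow> ('p \<Rightarrow> 'b::real_normed_vector) \<Rightarrow> 'p
    \<Rightarrow> complex ^ 'n \<Rightarrow> 'b" where
  "dir_deriv A f p = frechet_derivative (f \<circ> chart_inv (chart_at A p)) (at (snd (chart_at A p) p))"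

definition lie_bracket :: "('p, 'n::finite) chart set \<Rightarrow> ('p \<Rightarrow> complex ^ 'n) \<Rightarrow> ('p \<Rightarrow> complex ^ 'n)
    \<Rightarrow> 'p \<Rightarrow> complex ^ 'n" where
  "lie_bracket A X Y p = (let c = chart_at A p; x = snd c p in
     frechet_derivative (vf_rep A c Y) (at x) (X p) - frechet_derivative (vf_rep A c X) (at x) (Y p))"


section \<open>Differential forms, tensor fields, metrics and connections\<close>

text \<open>Tensor fields are smooth (holomorphic) if they take smooth (holomorphic) vector fields to
  smooth (holomorphic) functions or vector fields.\<close>

definition smooth_one_form :: "('p::topological_space, 'n::finite) chart set \<Rightarrow> 'p set
    \<Rightarrow> ('p \<Rightarrow> complex ^ 'n \<Rightarrow> real) \<Rightarrow> bool" where
  "smooth_one_form A W \<alpha> \<longleftrightarrow> (\<forall>p\<in>W. linear (\<alpha> p)) \<and>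
     (\<forall>W' X. open W' \<and> W' \<subseteq> W \<and> smooth_vf A W' X \<longrightarrow> smooth_fun A W' (\<lambda>p. \<alpha> p (X p)))"

definition hol_one_form :: "('p::topological_space, 'n::finite) chart set \<Rightarrow> 'p set
    \<Rightarrow> ('p \<Rightarrow> complex ^ 'n \<Rightarrow> complex) \<Rightarrow> bool" where
  "hol_one_form A W \<alpha> \<longleftrightarrow> (\<forall>p\<in>W. linear (\<alpha> p) \<and> (\<forall>x. \<alpha> p (J x) = \<i> * \<alpha> p x)) \<and>
     (\<forall>W' X. open W' \<and> W' \<subseteq> W \<and> hol_vf A W' X \<longrightarrow> hol_fun A W' (\<lambda>p. \<alpha> p (X p)))"

definition smooth_endo :: "('p::topological_space, 'n::finite) chart set \<Rightarrow> 'p set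
    \<Rightarrow> ('p \<Rightarrow> complex ^ 'n \<Rightarrow> complex ^ 'n) \<Rightarrow> bool" where
  "smooth_endo A W F \<longleftrightarrow> (\<forall>p\<in>W. linear (F p)) \<and>
     (\<forall>W' X. open W' \<and> W' \<subseteq> W \<and> smooth_vf A W' X \<longrightarrow> smooth_vf A W' (\<lambda>p. F p (X p)))"

definition riemannian_metric :: "('p::topological_space, 'n::finite) chart set
    \<Rightarrow> ('p \<Rightarrow> complex ^ 'n \<Rightarrow> complex ^ 'n \<Rightarrow> real) \<Rightarrow> bool" where
  "riemannian_metric A g \<longleftrightarrow>
     (\<forall>p. bilinear (g p) \<and> (\<forall>x y. g p x y = g p y x) \<and> (\<forall>x. x \<noteq> 0 \<longrightarrow> g p x x > 0)) \<and>
     (\<forall>W X Y. open W \<and> smooth_vf A W X \<and> smooth_vf A W Y \<longrightarrow> smooth_fun A W (\<lambda>p. g p (X p) (Y p)))"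

definition hermitian_metric :: "('p::topological_space, 'n::finite) chart set
    \<Rightarrow> ('p \<Rightarrow> complex ^ 'n \<Rightarrow> complex ^ 'n \<Rightarrow> real) \<Rightarrow> bool" where
  "hermitian_metric A g \<longleftrightarrow> riemannian_metric A g \<and> (\<forall>p x y. g p (J x) (J y) = g p x y)"

text \<open>Convention: \<open>2 d\<alpha>(X,Y) = X \<alpha>(Y) - Y \<alpha>(X) - \<alpha>([X,Y])\<close>.\<close>

definition ext_d :: "('p, 'n::finite) chart set \<Rightarrow> ('p \<Rightarrow> complex ^ 'n \<Rightarrow> 'b::real_normed_vector)
    \<Rightarrow> ('p \<Rightarrow> complex ^ 'n) \<Rightarrow> ('p \<Rightarrow> complex ^ 'n) \<Rightarrow> 'p \<Rightarrow> 'b" where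
  "ext_d A \<alpha> X Y p = (1/2) *\<^sub>R
     (dir_deriv A (\<lambda>q. \<alpha> q (Y q)) p (X p) - dir_deriv A (\<lambda>q. \<alpha> q (X q)) p (Y p)
        - \<alpha> p (lie_bracket A X Y p))"

text \<open>Convention: \<open>2 (\<alpha> \<and> \<beta>)(x,y) = \<alpha>(x) \<beta>(y) - \<alpha>(y) \<beta>(x)\<close>.\<close>

definition wedge :: "('a \<Rightarrow> real) \<Rightarrow> ('a \<Rightarrow> real) \<Rightarrow> 'a \<Rightarrow> 'a \<Rightarrow> real" where
  "wedge \<alpha> \<beta> x y = (\<alpha> x * \<beta> y - \<alpha> y * \<beta> x) / 2"

text \<open>The value of \<open>\<omega> \<and> (d\<omega>)^m\<close> on \<open>X 0, \<dots>, X (2 * m)\<close> at \<open>p\<close>, with the same convention for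
  wedge products (the alternation of the tensor product).\<close>

definition contact_volume :: "('p, 'n::finite) chart set \<Rightarrow> nat \<Rightarrow> ('p \<Rightarrow> complex ^ 'n \<Rightarrow> complex)
    \<Rightarrow> (nat \<Rightarrow> 'p \<Rightarrow> complex ^ 'n) \<Rightarrow> 'p \<Rightarrow> complex" where
  "contact_volume A m \<omega> X p = (1 / fact (2 * m + 1)) *
     (\<Sum>\<pi> | \<pi> permutes {..2 * m}. of_int (sign \<pi>) * \<omega> p (X (\<pi> 0) p) *
        (\<Prod>j<m. ext_d A \<omega> (X (\<pi> (2 * j + 1))) (X (\<pi> (2 * j + 2))) p))"

text \<open>\<open>nabla Y p x\<close> is the covariant derivative at \<open>p\<close>, in the direction \<open>x\<close>, of a vector field
  \<open>Y\<close> which is smooth in a neighbourhood of \<open>p\<close>. The Levi-Civita connection is the torsion-free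
  affine connection for which the metric is parallel.\<close>

definition affine_connection :: "('p::topological_space, 'n::finite) chart set
    \<Rightarrow> (('p \<Rightarrow> complex ^ 'n) \<Rightarrow> 'p \<Rightarrow> complex ^ 'n \<Rightarrow> complex ^ 'n) \<Rightarrow> bool" where
  "affine_connection A nabla \<longleftrightarrow> (\<forall>W X Y f.
     open W \<and> smooth_vf A W X \<and> smooth_vf A W Y \<and> smooth_fun A W (f :: 'p \<Rightarrow> real) \<longrightarrow>
       smooth_vf A W (\<lambda>p. nabla Y p (X p)) \<and>
       (\<forall>p\<in>W. linear (nabla Y p) \<and>
         (\<forall>x. nabla (\<lambda>q. X q + Y q) p x = nabla X p x + nabla Y p x) \<and>
         (\<forall>x. nabla (\<lambda>q. f q *\<^sub>R Y q) p x = dir_deriv A f p x *\<^sub>R Y p + f p *\<^sub>R nabla Y p x)))"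

definition levi_civita :: "('p::topological_space, 'n::finite) chart set
    \<Rightarrow> ('p \<Rightarrow> complex ^ 'n \<Rightarrow> complex ^ 'n \<Rightarrow> real)
    \<Rightarrow> (('p \<Rightarrow> complex ^ 'n) \<Rightarrow> 'p \<Rightarrow> complex ^ 'n \<Rightarrow> complex ^ 'n) \<Rightarrow> bool" where
  "levi_civita A g nabla \<longleftrightarrow> affine_connection A nabla \<and>
     (\<forall>W X Y. open W \<and> smooth_vf A W X \<and> smooth_vf A W Y \<longrightarrow> (\<forall>p\<in>W.
        nabla Y p (X p) - nabla X p (Y p) = lie_bracket A X Y p \<and>
        (\<forall>z. dir_deriv A (\<lambda>q. g q (X q) (Y q)) p z = g p (nabla X p z) (Y p) + g p (X p) (nabla Y p z))))"

text \<open>\<open>cov_endo nabla F L p x\<close> is \<open>(\<nabla>\<^sub>x F) L\<close> at \<open>p\<close>, and \<open>nijenhuis\<close> is \<open>[F,F](K,L)\<close>.\<close>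

definition cov_endo :: "(('p \<Rightarrow> complex ^ 'n) \<Rightarrow> 'p \<Rightarrow> complex ^ 'n \<Rightarrow> complex ^ 'n)
    \<Rightarrow> ('p \<Rightarrow> complex ^ 'n \<Rightarrow> complex ^ 'n) \<Rightarrow> ('p \<Rightarrow> complex ^ 'n) \<Rightarrow> 'p \<Rightarrow> complex ^ 'n \<Rightarrow> complex ^ 'n" where
  "cov_endo nabla F L p x = nabla (\<lambda>q. F q (L q)) p x - F p (nabla L p x)"

definition nijenhuis :: "(('p \<Rightarrow> complex ^ 'n) \<Rightarrow> 'p \<Rightarrow> complex ^ 'n \<Rightarrow> complex ^ 'n)
    \<Rightarrow> ('p \<Rightarrow> complex ^ 'n \<Rightarrow> complex ^ 'n)
    \<Rightarrow> ('p \<Rightarrow> complex ^ 'n) \<Rightarrow> ('p \<Rightarrow> complex ^ 'n) \<Rightarrow> 'p \<Rightarrow> complex ^ 'n" where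
  "nijenhuis nabla F K L p =
     cov_endo nabla F L p (F p (K p)) - cov_endo nabla F K p (F p (L p))
     - F p (cov_endo nabla F L p (K p)) + F p (cov_endo nabla F K p (L p))"


section \<open>Complex contact metric manifolds\<close>

locale complex_contact_manifold =
  fixes A :: "('p::{t2_space,second_countable_topology}, 'n::finite) chart set"
    and m :: nat
    and I :: "'i set"
    and N :: "'i \<Rightarrow> 'p set"
    and \<omega> :: "'i \<Rightarrow> 'p \<Rightarrow> complex ^ 'n \<Rightarrow> complex"
  assumes atlas: "complex_atlas A"
    and dim: "CARD('n) = 2 * m + 1"
    and cover: "(\<Union>i\<in>I. N i) = UNIV"
    and nbhd: "i \<in> I \<Longrightarrow> coordinate_nbhd A (N i)"
    and contact_form: "i \<in> I \<Longrightarrow> hol_one_form A (N i) (\<omega> i)"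
    and contact: "i \<in> I \<Longrightarrow> p \<in> N i \<Longrightarrow>
      \<exists>W X. open W \<and> p \<in> W \<and> (\<forall>a. smooth_vf A W (X a)) \<and> contact_volume A m (\<omega> i) X p \<noteq> 0"
    and contact_overlap: "i \<in> I \<Longrightarrow> j \<in> I \<Longrightarrow> N i \<inter> N j \<noteq> {} \<Longrightarrow>
      \<exists>f. hol_fun A (N i \<inter> N j) f \<and> (\<forall>p\<in>N i \<inter> N j. \<forall>x. \<omega> i p x = f p * \<omega> j p x)"

locale complex_almost_contact_metric_manifold = complex_contact_manifold A m I N \<omega>
  for A :: "('p::{t2_space,second_countable_topology}, 'n::finite) chart set"
    and m :: nat
    and I :: "'i set"
    and N :: "'i \<Rightarrow> 'p set"
    and \<omega> :: "'i \<Rightarrow> 'p \<Rightarrow> complex ^ 'n \<Rightarrow> complex" +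
  fixes g :: "'p \<Rightarrow> complex ^ 'n \<Rightarrow> complex ^ 'n \<Rightarrow> real"
    and u v :: "'i \<Rightarrow> 'p \<Rightarrow> complex ^ 'n \<Rightarrow> real"
    and U V :: "'i \<Rightarrow> 'p \<Rightarrow> complex ^ 'n"
    and G H :: "'i \<Rightarrow> 'p \<Rightarrow> complex ^ 'n \<Rightarrow> complex ^ 'n"
  assumes hermitian: "hermitian_metric A g"
    and u_smooth: "i \<in> I \<Longrightarrow> smooth_one_form A (N i) (u i)"
    and U_smooth: "i \<in> I \<Longrightarrow> smooth_vf A (N i) (U i)"
    and G_smooth: "i \<in> I \<Longrightarrow> smooth_endo A (N i) (G i)"
    and v_eq: "i \<in> I \<Longrightarrow> p \<in> N i \<Longrightarrow> v i p x = u i p (J x)"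
    and V_eq: "i \<in> I \<Longrightarrow> p \<in> N i \<Longrightarrow> V i p = - J (U i p)"
    and H_eq: "i \<in> I \<Longrightarrow> p \<in> N i \<Longrightarrow> H i p x = G i p (J x)"
    and U_dual: "i \<in> I \<Longrightarrow> p \<in> N i \<Longrightarrow> u i p x = g p (U i p) x"
    and U_unit: "i \<in> I \<Longrightarrow> p \<in> N i \<Longrightarrow> g p (U i p) (U i p) = 1"
    and G_sq: "i \<in> I \<Longrightarrow> p \<in> N i \<Longrightarrow> G i p (G i p x) = - x + u i p x *\<^sub>R U i p + v i p x *\<^sub>R V i p"
    and H_sq: "i \<in> I \<Longrightarrow> p \<in> N i \<Longrightarrow> H i p (H i p x) = - x + u i p x *\<^sub>R U i p + v i p x *\<^sub>R V i p"
    and GJ: "i \<in> I \<Longrightarrow> p \<in> N i \<Longrightarrow> G i p (J x) = - J (G i p x)"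
    and GU: "i \<in> I \<Longrightarrow> p \<in> N i \<Longrightarrow> G i p (U i p) = 0"
    and G_skew: "i \<in> I \<Longrightarrow> p \<in> N i \<Longrightarrow> g p x (G i p y) = - g p (G i p x) y"
    and metric_overlap: "i \<in> I \<Longrightarrow> j \<in> I \<Longrightarrow> N i \<inter> N j \<noteq> {} \<Longrightarrow>
      \<exists>c d. \<forall>p\<in>N i \<inter> N j. (c p)\<^sup>2 + (d p)\<^sup>2 = (1::real) \<and>
        (\<forall>x. u j p x = c p * u i p x - d p * v i p x \<and>
             v j p x = d p * u i p x + c p * v i p x \<and>
             G j p x = c p *\<^sub>R G i p x - d p *\<^sub>R H i p x \<and>
             H j p x = d p *\<^sub>R G i p x + c p *\<^sub>R H i p x)"

locale complex_contact_metric_manifold =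
  complex_almost_contact_metric_manifold A m I N \<omega> g u v U V G H
  for A :: "('p::{t2_space,second_countable_topology}, 'n::finite) chart set"
    and m :: nat
    and I :: "'i set"
    and N :: "'i \<Rightarrow> 'p set"
    and \<omega> :: "'i \<Rightarrow> 'p \<Rightarrow> complex ^ 'n \<Rightarrow> complex"
    and g :: "'p \<Rightarrow> complex ^ 'n \<Rightarrow> complex ^ 'n \<Rightarrow> real"
    and u v :: "'i \<Rightarrow> 'p \<Rightarrow> complex ^ 'n \<Rightarrow> real"
    and U V :: "'i \<Rightarrow> 'p \<Rightarrow> complex ^ 'n"
    and G H :: "'i \<Rightarrow> 'p \<Rightarrow> complex ^ 'n \<Rightarrow> complex ^ 'n" +
  fixes nabla :: "('p \<Rightarrow> complex ^ 'n) \<Rightarrow> 'p \<Rightarrow> complex ^ 'n \<Rightarrow> complex ^ 'n"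
    and \<sigma> :: "'i \<Rightarrow> 'p \<Rightarrow> complex ^ 'n \<Rightarrow> real"
  assumes nabla: "levi_civita A g nabla"
    and \<sigma>_eq: "i \<in> I \<Longrightarrow> p \<in> N i \<Longrightarrow> \<sigma> i p x = g p (nabla (U i) p x) (V i p)"
    and horizontal_eq: "i \<in> I \<Longrightarrow> p \<in> N i \<Longrightarrow> {x. \<omega> i p x = 0} = {x. u i p x = 0 \<and> v i p x = 0}"
    and du: "i \<in> I \<Longrightarrow> open W \<Longrightarrow> W \<subseteq> N i \<Longrightarrow> smooth_vf A W K \<Longrightarrow> smooth_vf A W L \<Longrightarrow> p \<in> W \<Longrightarrow>
      ext_d A (u i) K L p = g p (K p) (G i p (L p)) + wedge (\<sigma> i p) (v i p) (K p) (L p)"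
    and dv: "i \<in> I \<Longrightarrow> open W \<Longrightarrow> W \<subseteq> N i \<Longrightarrow> smooth_vf A W K \<Longrightarrow> smooth_vf A W L \<Longrightarrow> p \<in> W \<Longrightarrow>
      ext_d A (v i) K L p = g p (K p) (H i p (L p)) - wedge (\<sigma> i p) (u i p) (K p) (L p)"
begin

definition S_tensor :: "'i \<Rightarrow> ('p \<Rightarrow> complex ^ 'n) \<Rightarrow> ('p \<Rightarrow> complex ^ 'n) \<Rightarrow> 'p \<Rightarrow> complex ^ 'n" where
  "S_tensor i K L p =
     nijenhuis nabla (G i) K L p
     + (2 * g p (K p) (G i p (L p))) *\<^sub>R U i p - (2 * g p (K p) (H i p (L p))) *\<^sub>R V i p
     + 2 *\<^sub>R (v i p (L p) *\<^sub>R H i p (K p) - v i p (K p) *\<^sub>R H i p (L p))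
     + \<sigma> i p (G i p (L p)) *\<^sub>R H i p (K p) - \<sigma> i p (G i p (K p)) *\<^sub>R H i p (L p)
     + \<sigma> i p (K p) *\<^sub>R G i p (H i p (L p)) - \<sigma> i p (L p) *\<^sub>R G i p (H i p (K p))"

definition T_tensor :: "'i \<Rightarrow> ('p \<Rightarrow> complex ^ 'n) \<Rightarrow> ('p \<Rightarrow> complex ^ 'n) \<Rightarrow> 'p \<Rightarrow> complex ^ 'n" where
  "T_tensor i K L p =
     nijenhuis nabla (H i) K L p
     - (2 * g p (K p) (G i p (L p))) *\<^sub>R U i p + (2 * g p (K p) (H i p (L p))) *\<^sub>R V i p
     + 2 *\<^sub>R (u i p (L p) *\<^sub>R G i p (K p) - u i p (K p) *\<^sub>R G i p (L p))
     + \<sigma> i p (H i p (K p)) *\<^sub>R G i p (L p) - \<sigma> i p (H i p (L p)) *\<^sub>R G i p (K p)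
     + \<sigma> i p (K p) *\<^sub>R G i p (H i p (L p)) - \<sigma> i p (L p) *\<^sub>R G i p (H i p (K p))"

end

locale normal_complex_contact_metric_manifold =
  complex_contact_metric_manifold A m I N \<omega> g u v U V G H nabla \<sigma>
  for A :: "('p::{t2_space,second_countable_topology}, 'n::finite) chart set"
    and m :: nat
    and I :: "'i set"
    and N :: "'i \<Rightarrow> 'p set"
    and \<omega> :: "'i \<Rightarrow> 'p \<Rightarrow> complex ^ 'n \<Rightarrow> complex"
    and g :: "'p \<Rightarrow> complex ^ 'n \<Rightarrow> complex ^ 'n \<Rightarrow> real"
    and u v :: "'i \<Rightarrow> 'p \<Rightarrow> complex ^ 'n \<Rightarrow> real"
    and U V :: "'i \<Rightarrow> 'p \<Rightarrow> complex ^ 'n"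
    and G H :: "'i \<Rightarrow> 'p \<Rightarrow> complex ^ 'n \<Rightarrow> complex ^ 'n"
    and nabla :: "('p \<Rightarrow> complex ^ 'n) \<Rightarrow> 'p \<Rightarrow> complex ^ 'n \<Rightarrow> complex ^ 'n"
    and \<sigma> :: "'i \<Rightarrow> 'p \<Rightarrow> complex ^ 'n \<Rightarrow> real" +
  assumes normal_horizontal:
      "i \<in> I \<Longrightarrow> open W \<Longrightarrow> W \<subseteq> N i \<Longrightarrow> smooth_vf A W K \<Longrightarrow> smooth_vf A W L \<Longrightarrow>
       (\<forall>q\<in>W. \<omega> i q (K q) = 0 \<and> \<omega> i q (L q) = 0) \<Longrightarrow> p \<in> W \<Longrightarrow>
       S_tensor i K L p = 0 \<and> T_tensor i K L p = 0"
    and normal_vertical: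
      "i \<in> I \<Longrightarrow> open W \<Longrightarrow> W \<subseteq> N i \<Longrightarrow> smooth_vf A W K \<Longrightarrow> p \<in> W \<Longrightarrow>
       S_tensor i K (U i) p = 0 \<and> T_tensor i K (V i) p = 0"


section \<open>Complex submanifolds and distributions\<close>

definition diff_map :: "('q, 'k::finite) chart set \<Rightarrow> ('p, 'n::finite) chart set \<Rightarrow> ('q \<Rightarrow> 'p) \<Rightarrow> 'q
    \<Rightarrow> complex ^ 'k \<Rightarrow> complex ^ 'n" where
  "diff_map B A F q = frechet_derivative (snd (chart_at A (F q)) \<circ> F \<circ> chart_inv (chart_at B q))
     (at (snd (chart_at B q) q))"

text \<open>A complex submanifold of the manifold with atlas \<open>A\<close>: a complex manifold, with atlas \<open>B\<close>, together
  with an injective holomorphic immersion \<open>F\<close> (the inclusion).\<close>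

locale complex_submanifold =
  fixes A :: "('p::{t2_space,second_countable_topology}, 'n::finite) chart set"
    and B :: "('q::{t2_space,second_countable_topology}, 'k::finite) chart set"
    and F :: "'q \<Rightarrow> 'p"
  assumes ambient_atlas: "complex_atlas A"
    and sub_atlas: "complex_atlas B"
    and F_cont: "continuous_on UNIV F"
    and F_hol: "b \<in> B \<Longrightarrow> c \<in> A \<Longrightarrow>
      hol_map_on (snd b ` (fst b \<inter> F -` fst c)) (snd c \<circ> F \<circ> chart_inv b)"
    and F_immersion: "inj (diff_map B A F q)"
    and F_inj: "inj F"

text \<open>A smooth distribution is a smooth subbundle of the tangent bundle, i.e. it has smooth local frames.\<close>

definition smooth_distribution :: "('q::topological_space, 'k::finite) chart set
    \<Rightarrow> ('q \<Rightarrow> (complex ^ 'k) set) \<Rightarrow> bool" where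
  "smooth_distribution B D \<longleftrightarrow> (\<forall>q. \<exists>W r X. open W \<and> q \<in> W \<and> (\<forall>a<r. smooth_vf B W (X a)) \<and>
     (\<forall>q'\<in>W. inj_on (\<lambda>a. X a q') {..<(r::nat)} \<and> independent ((\<lambda>a. X a q') ` {..<r}) \<and>
        D q' = span ((\<lambda>a. X a q') ` {..<r})))"

definition sections :: "('q::topological_space, 'k::finite) chart set \<Rightarrow> ('q \<Rightarrow> (complex ^ 'k) set)
    \<Rightarrow> 'q set \<Rightarrow> ('q \<Rightarrow> complex ^ 'k) set" where
  "sections B D W = {X. smooth_vf B W X \<and> (\<forall>q\<in>W. X q \<in> D q)}"

text \<open>Sections over arbitrary open sets; \<open>W = UNIV\<close> gives the global sections.\<close>

definition involutive :: "('q::topological_space, 'k::finite) chart set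
    \<Rightarrow> ('q \<Rightarrow> (complex ^ 'k) set) \<Rightarrow> bool" where
  "involutive B D \<longleftrightarrow> (\<forall>W. open W \<longrightarrow>
     (\<forall>K\<in>sections B D W. \<forall>L\<in>sections B D W. lie_bracket B K L \<in> sections B D W))"

text \<open>Distributions on the submanifold are families of subspaces of its own tangent spaces, which
  \<open>diff_map B A F q\<close> embeds in those of the ambient manifold; \<open>vert i q\<close> is the span of
  \<open>U i\<close> and \<open>V i\<close>, as a subspace of the tangent space of the submanifold at \<open>q\<close>.\<close>

locale semi_invariant_submanifold =
  normal_complex_contact_metric_manifold A m I N \<omega> g u v U V G H nabla \<sigma> + complex_submanifold A B F
  for A :: "('p::{t2_space,second_countable_topology}, 'n::finite) chart set"
    and m :: nat
    and I :: "'i set"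
    and N :: "'i \<Rightarrow> 'p set"
    and \<omega> :: "'i \<Rightarrow> 'p \<Rightarrow> complex ^ 'n \<Rightarrow> complex"
    and g :: "'p \<Rightarrow> complex ^ 'n \<Rightarrow> complex ^ 'n \<Rightarrow> real"
    and u v :: "'i \<Rightarrow> 'p \<Rightarrow> complex ^ 'n \<Rightarrow> real"
    and U V :: "'i \<Rightarrow> 'p \<Rightarrow> complex ^ 'n"
    and G H :: "'i \<Rightarrow> 'p \<Rightarrow> complex ^ 'n \<Rightarrow> complex ^ 'n"
    and nabla :: "('p \<Rightarrow> complex ^ 'n) \<Rightarrow> 'p \<Rightarrow> complex ^ 'n \<Rightarrow> complex ^ 'n"
    and \<sigma> :: "'i \<Rightarrow> 'p \<Rightarrow> complex ^ 'n \<Rightarrow> real"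
    and B :: "('q::{t2_space,second_countable_topology}, 'k::finite) chart set"
    and F :: "'q \<Rightarrow> 'p" +
  fixes n :: nat
    and D D_perp :: "'q \<Rightarrow> (complex ^ 'k) set"
    and vert :: "'i \<Rightarrow> 'q \<Rightarrow> (complex ^ 'k) set"
  assumes real_dim: "2 * CARD('k) = n + 2"
    and U_tangent: "i \<in> I \<Longrightarrow> F q \<in> N i \<Longrightarrow> U i (F q) \<in> range (diff_map B A F q)"
    and V_tangent: "i \<in> I \<Longrightarrow> F q \<in> N i \<Longrightarrow> V i (F q) \<in> range (diff_map B A F q)"
    and vert_eq: "i \<in> I \<Longrightarrow> F q \<in> N i \<Longrightarrow> vert i q = diff_map B A F q -` span {U i (F q), V i (F q)}"
    and D_smooth: "smooth_distribution B D"
    and D_perp_smooth: "smooth_distribution B D_perp"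
    and D_orth_D_perp: "x \<in> D q \<Longrightarrow> y \<in> D_perp q \<Longrightarrow>
      g (F q) (diff_map B A F q x) (diff_map B A F q y) = 0"
    and D_orth_vert: "i \<in> I \<Longrightarrow> F q \<in> N i \<Longrightarrow> x \<in> D q \<Longrightarrow> z \<in> vert i q \<Longrightarrow>
      g (F q) (diff_map B A F q x) (diff_map B A F q z) = 0"
    and D_perp_orth_vert: "i \<in> I \<Longrightarrow> F q \<in> N i \<Longrightarrow> y \<in> D_perp q \<Longrightarrow> z \<in> vert i q \<Longrightarrow>
      g (F q) (diff_map B A F q y) (diff_map B A F q z) = 0"
    and decomposition: "i \<in> I \<Longrightarrow> F q \<in> N i \<Longrightarrow>
      UNIV = {x + y + z | x y z. x \<in> D q \<and> y \<in> D_perp q \<and> z \<in> vert i q}"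
    and G_D: "i \<in> I \<Longrightarrow> F q \<in> N i \<Longrightarrow>
      G i (F q) ` (diff_map B A F q ` D q) = diff_map B A F q ` D q"
    and H_D: "i \<in> I \<Longrightarrow> F q \<in> N i \<Longrightarrow>
      H i (F q) ` (diff_map B A F q ` D q) = diff_map B A F q ` D q"
    and G_D_perp: "i \<in> I \<Longrightarrow> F q \<in> N i \<Longrightarrow> y \<in> D_perp q \<Longrightarrow>
      g (F q) (G i (F q) (diff_map B A F q y)) (diff_map B A F q w) = 0"
    and H_D_perp: "i \<in> I \<Longrightarrow> F q \<in> N i \<Longrightarrow> y \<in> D_perp q \<Longrightarrow>
      g (F q) (H i (F q) (diff_map B A F q y)) (diff_map B A F q w) = 0"

end

(* Pull the forms u, v back to the submanifold along the inclusion F. For fields X, Y on it that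
   are annihilated by both pulled back forms, the structure equation for du becomes
   u(dF [X,Y]) = -2 g(dF X, G dF Y), and likewise for v and H. For K, L in the anti-invariant
   distribution the right-hand sides vanish, so [K,L] is orthogonal to U and V. For X in the
   invariant distribution the same holds for [L,X] and [X,K], so applying u to the Jacobi identity
   for K, L, X leaves only g(dF [K,L], G dF X) = 0; as G maps the invariant distribution onto
   itself, [K,L] is orthogonal to it. *)
theory Submission
  imports Defs
begin

section \<open>Calculus of smooth maps between Euclidean spaces\<close>

text \<open>The order of the two stages is forced by the terms \<open>wedge \<sigma> v\<close> and
  \<open>wedge \<sigma> u\<close> of the structure equations: they vanish only on fields killed by
  both \<open>u\<close> and \<open>v\<close>. The inner brackets must therefore be known to be
  horizontal near the point before the equations can be applied to a double bracket. In the Jacobi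
  identity two of the three terms then pair a tangent vector with \<open>G\<close> applied to an
  anti-invariant one, which is normal. The argument amounts to d(du) = 0 evaluated on K, L, X. The
  factor -2 comes from the convention for \<open>ext_d\<close>, which halves the usual exterior
  derivative. The obstacle is the encoding of tangent vectors by components in a chart chosen
  separately at each point. This choice need not vary continuously, so a field can be differentiated
  only after it has been rewritten in one fixed chart; the calculus in Euclidean space and the chart
  independence of brackets and differentials serve this purpose.\<close>

abbreviation fd :: "('a::real_normed_vector \<Rightarrow> 'b::real_normed_vector) \<Rightarrow> 'a \<Rightarrow> 'a \<Rightarrow> 'b" where
  "fd f x \<equiv> frechet_derivative f (at x)"

lemma fd_eqI: "(f has_derivative f') (at x) \<Longrightarrow> fd f x = f'"
  using frechet_derivative_at by metis

lemma fd_cong: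
  assumes "open S" "x \<in> S" "\<And>y. y \<in> S \<Longrightarrow> f y = g y" "f differentiable (at x)"
  shows "fd f x = fd g x" "g differentiable (at x)"
proof -
  have "(g has_derivative fd f x) (at x)"
    using assms has_derivative_transform_within_open frechet_derivative_works by metis
  then show "fd f x = fd g x" "g differentiable (at x)"
    using fd_eqI differentiableI by metis+
qed

section \<open>Closure properties of k times continuously differentiable maps\<close>

lemma Ck_on_cong:
  assumes "open S" "\<And>x. x \<in> S \<Longrightarrow> f x = g x" "Ck_on k S f"
  shows "Ck_on k S g"
  using assms(2,3)
proof (induction k arbitrary: f g)
  case 0
  then show ?case by (metis Ck_on.simps(1) continuous_on_eq)
next
  case (Suc k)
  have d: "f differentiable (at x)" if "x \<in> S" for x using Suc that by simp
  have "g differentiable (at x)" if "x \<in> S" for x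
    using fd_cong(2)[OF assms(1) that Suc.prems(1) d[OF that]] .
  moreover have "Ck_on k S (\<lambda>x. fd g x v)" for v
  proof (rule Suc.IH)
    show "fd f x v = fd g x v" if "x \<in> S" for x
      using fd_cong(1)[OF assms(1) that Suc.prems(1) d[OF that]] by simp
  qed (use Suc.prems in simp)
  ultimately show ?case by simp
qed

lemma Ck_on_subset: "Ck_on k S f \<Longrightarrow> T \<subseteq> S \<Longrightarrow> Ck_on k T f"
proof (induction k arbitrary: f)
  case 0
  then show ?case using continuous_on_subset by auto
next
  case (Suc k)
  then show ?case by (simp add: subset_iff)
qed

lemma Ck_on_decSuc: "Ck_on (Suc k) S f \<Longrightarrow> Ck_on k S f"
  by (induction k arbitrary: f)
    (auto simp: continuous_on_eq_continuous_at intro!: continuous_at_imp_continuous_on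
      differentiable_imp_continuous_within)

lemma Ck_on_const: "Ck_on k S (\<lambda>x. c)"
  by (induction k arbitrary: c) auto

lemma Ck_on_bounded_linear:
  assumes h: "bounded_linear h" and S: "open S" and "Ck_on k S f"
  shows "Ck_on k S (\<lambda>x. h (f x))"
  using assms(3)
proof (induction k arbitrary: f)
  case 0
  then show ?case using h bounded_linear.continuous_on by auto
next
  case (Suc k)
  have D: "((\<lambda>x. h (f x)) has_derivative (\<lambda>v. h (fd f x v))) (at x)" if "x \<in> S" for x
    using Suc.prems that by (intro bounded_linear.has_derivative[OF h]) (simp add: frechet_derivative_works)
  have "Ck_on k S (\<lambda>x. fd (\<lambda>x. h (f x)) x v)" for v
    by (rule Ck_on_cong[OF S _ Suc.IH[of "\<lambda>x. fd f x v"]]) (use fd_eqI[OF D] Suc.prems in auto)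
  then show ?case using D differentiableI by force
qed

lemma Ck_on_add:
  assumes S: "open S" and "Ck_on k S f" "Ck_on k S g"
  shows "Ck_on k S (\<lambda>x. f x + g x)"
  using assms(2,3)
proof (induction k arbitrary: f g)
  case 0
  then show ?case by (auto intro: continuous_intros)
next
  case (Suc k)
  have D: "((\<lambda>x. f x + g x) has_derivative (\<lambda>v. fd f x v + fd g x v)) (at x)" if "x \<in> S" for x
    using Suc.prems that by (auto intro!: has_derivative_add simp: frechet_derivative_works)
  have "Ck_on k S (\<lambda>x. fd (\<lambda>x. f x + g x) x v)" for v
    by (rule Ck_on_cong[OF S _ Suc.IH[of "\<lambda>x. fd f x v" "\<lambda>x. fd g x v"]]) (use D fd_eqI Suc.prems in force)+
  then show ?case using D differentiableI by force
qed

lemma Ck_on_sum: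
  assumes S: "open S" and "\<And>i. i \<in> M \<Longrightarrow> Ck_on k S (f i)"
  shows "Ck_on k S (\<lambda>x. \<Sum>i\<in>M. f i x)"
  using assms(2)
  by (induction M rule: infinite_finite_induct) (auto intro: Ck_on_const Ck_on_add[OF S])

lemma Ck_on_scaleR:
  assumes S: "open S" and "Ck_on k S f" "Ck_on k S g"
  shows "Ck_on k S (\<lambda>x. f x *\<^sub>R g x)"
  using assms(2,3)
proof (induction k arbitrary: f g)
  case 0
  then show ?case by (auto intro: continuous_intros)
next
  case (Suc k)
  have D: "((\<lambda>x. f x *\<^sub>R g x) has_derivative (\<lambda>v. f x *\<^sub>R fd g x v + fd f x v *\<^sub>R g x)) (at x)" if "x \<in> S" for x
    using Suc.prems that by (auto intro!: has_derivative_scaleR simp: frechet_derivative_works)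
  have "Ck_on k S (\<lambda>x. fd (\<lambda>x. f x *\<^sub>R g x) x v)" for v
  proof (rule Ck_on_cong[OF S])
    show "Ck_on k S (\<lambda>x. f x *\<^sub>R fd g x v + fd f x v *\<^sub>R g x)"
      by (intro Ck_on_add[OF S] Suc.IH Ck_on_decSuc[OF Suc.prems(1)] Ck_on_decSuc[OF Suc.prems(2)])
        (use Suc.prems in auto)
  qed (use D fd_eqI in force)
  then show ?case using D differentiableI by force
qed

text \<open>\<open>Ck_on\<close> controls derivatives in fixed directions only. Expanding a
  direction that moves with the point in the basis reduces it to finitely many fixed ones with
  varying coefficients.\<close>

lemma fd_euclidean_sum:
  fixes f :: "'a::euclidean_space \<Rightarrow> 'b::real_normed_vector"
  assumes "f differentiable (at x)"
  shows "fd f x v = (\<Sum>i\<in>Basis. (v \<bullet> i) *\<^sub>R fd f x i)"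
proof -
  have l: "linear (fd f x)" using assms linear_frechet_derivative by blast
  have "fd f x v = fd f x (\<Sum>i\<in>Basis. (v \<bullet> i) *\<^sub>R i)" by (simp add: euclidean_representation)
  then show ?thesis by (simp add: linear_sum[OF l] linear_scale[OF l])
qed

lemma Ck_on_fd_apply:
  fixes f :: "'a::euclidean_space \<Rightarrow> 'b::real_normed_vector"
  assumes S: "open S" and f: "Ck_on (Suc k) S f" and h: "Ck_on k S h"
  shows "Ck_on k S (\<lambda>x. fd f x (h x))"
proof (rule Ck_on_cong[OF S])
  show "Ck_on k S (\<lambda>x. \<Sum>i\<in>Basis. (h x \<bullet> i) *\<^sub>R fd f x i)"
    using f by (intro Ck_on_sum Ck_on_scaleR Ck_on_bounded_linear[OF bounded_linear_inner_left] S h) auto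
  show "(\<Sum>i\<in>Basis. (h x \<bullet> i) *\<^sub>R fd f x i) = fd f x (h x)" if "x \<in> S" for x
    using f that by (intro fd_euclidean_sum[symmetric]) simp
qed

text \<open>The chain rule produces the derivative of \<open>g\<close> in the moving direction
  \<open>fd f x v\<close>. After expansion in the basis the remaining factors are again composites
  with \<open>f\<close>, now of a derivative of \<open>g\<close>, so the induction has to be stated
  for arbitrary \<open>g\<close>.\<close>

lemma Ck_on_compose:
  fixes f :: "'a::euclidean_space \<Rightarrow> 'b::euclidean_space"
  assumes S: "open S" and T: "f ` S \<subseteq> T" and "Ck_on k S f" "Ck_on k T g"
  shows "Ck_on k S (\<lambda>x. g (f x))"
  using assms(3,4)
proof (induction k arbitrary: g)
  case 0
  then show ?case using T by (auto intro: continuous_on_compose2)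
next
  case (Suc k)
  have D: "((\<lambda>x. g (f x)) has_derivative (\<lambda>v. fd g (f x) (fd f x v))) (at x)" if "x \<in> S" for x
    using Suc.prems that T
    by (intro has_derivative_compose[of f "fd f x" x UNIV g "fd g (f x)"]) (auto simp: frechet_derivative_works[symmetric])
  have "Ck_on k S (\<lambda>x. fd (\<lambda>x. g (f x)) x v)" for v
  proof (rule Ck_on_cong[OF S])
    show "Ck_on k S (\<lambda>x. \<Sum>i\<in>Basis. (fd f x v \<bullet> i) *\<^sub>R fd g (f x) i)"
    proof (intro Ck_on_sum Ck_on_scaleR Ck_on_bounded_linear[OF bounded_linear_inner_left] S)
      show "Ck_on k S (\<lambda>x. fd f x v)" using Suc.prems by simp
      show "Ck_on k S (\<lambda>x. fd g (f x) i)" for i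
        by (rule Suc.IH) (use Suc.prems Ck_on_decSuc in \<open>blast, simp\<close>)
    qed
    show "(\<Sum>i\<in>Basis. (fd f x v \<bullet> i) *\<^sub>R fd g (f x) i) = fd (\<lambda>x. g (f x)) x v" if "x \<in> S" for x
    proof -
      have "g differentiable (at (f x))" using Suc.prems T that by auto
      then show ?thesis using fd_euclidean_sum fd_eqI[OF D[OF that]] by metis
    qed
  qed
  then show ?case using D differentiableI by force
qed

section \<open>The same closure properties for smooth maps\<close>

lemma smooth_on_cong: "open S \<Longrightarrow> (\<And>x. x \<in> S \<Longrightarrow> f x = g x) \<Longrightarrow> smooth_on S f \<Longrightarrow> smooth_on S g"
  using Ck_on_cong unfolding smooth_on_def by blast

lemma smooth_on_subset: "smooth_on S f \<Longrightarrow> T \<subseteq> S \<Longrightarrow> smooth_on T f"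
  using Ck_on_subset unfolding smooth_on_def by blast

lemma smooth_on_bounded_linear:
  "bounded_linear h \<Longrightarrow> open S \<Longrightarrow> smooth_on S f \<Longrightarrow> smooth_on S (\<lambda>x. h (f x))"
  using Ck_on_bounded_linear unfolding smooth_on_def by blast

lemma smooth_on_diff:
  "open S \<Longrightarrow> smooth_on S f \<Longrightarrow> smooth_on S g \<Longrightarrow> smooth_on S (\<lambda>x. f x - g x)"
  using Ck_on_add[of S _ f "\<lambda>x. - g x"] Ck_on_bounded_linear[OF bounded_linear_minus[OF bounded_linear_ident], of S _ g]
  unfolding smooth_on_def by simp

lemma smooth_on_fd: "smooth_on S f \<Longrightarrow> smooth_on S (\<lambda>x. fd f x v)"
  unfolding smooth_on_def using Ck_on.simps(2) by blast

lemma smooth_on_fd_apply: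
  fixes f :: "'a::euclidean_space \<Rightarrow> 'b::real_normed_vector"
  shows "open S \<Longrightarrow> smooth_on S f \<Longrightarrow> smooth_on S h \<Longrightarrow> smooth_on S (\<lambda>x. fd f x (h x))"
  using Ck_on_fd_apply unfolding smooth_on_def by blast

lemma smooth_on_compose:
  fixes f :: "'a::euclidean_space \<Rightarrow> 'b::euclidean_space"
  shows "open S \<Longrightarrow> f ` S \<subseteq> T \<Longrightarrow> smooth_on S f \<Longrightarrow> smooth_on T g \<Longrightarrow> smooth_on S (\<lambda>x. g (f x))"
  using Ck_on_compose unfolding smooth_on_def by blast

lemma smooth_on_differentiable: "smooth_on S f \<Longrightarrow> x \<in> S \<Longrightarrow> f differentiable (at x)"
  unfolding smooth_on_def by (metis Ck_on.simps(2))

lemma smooth_on_has_derivative: "smooth_on S f \<Longrightarrow> x \<in> S \<Longrightarrow> (f has_derivative fd f x) (at x)"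
  using smooth_on_differentiable frechet_derivative_works by blast

lemma smooth_on_linear_fd: "smooth_on S f \<Longrightarrow> x \<in> S \<Longrightarrow> linear (fd f x)"
  using smooth_on_differentiable linear_frechet_derivative by blast

lemma smooth_on_continuous: "smooth_on S f \<Longrightarrow> continuous_on S f"
  unfolding smooth_on_def by (metis Ck_on.simps(1))

section \<open>Symmetry of the second derivative\<close>

text \<open>The mean value theorem applied twice to the second difference over a parallelogram,
  first along \<open>a\<close> and then along \<open>b\<close>. The left-hand side is symmetric in
  \<open>a\<close> and \<open>b\<close>, the right-hand side is not visibly so; this is what yields
  Schwarz's theorem.\<close>

lemma mixed_difference:
  fixes f :: "'a::real_normed_vector \<Rightarrow> real"
  assumes f: "smooth_on S f" and h: "0 < h"
    and S: "\<And>s t. 0 \<le> s \<Longrightarrow> s \<le> h \<Longrightarrow> 0 \<le> t \<Longrightarrow> t \<le> h \<Longrightarrow> x + s *\<^sub>R a + t *\<^sub>R b \<in> S"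
  obtains s t where "0 < s" "s < h" "0 < t" "t < h"
    "f (x + h *\<^sub>R a + h *\<^sub>R b) - f (x + h *\<^sub>R a) - f (x + h *\<^sub>R b) + f x
      = h * (h * fd (\<lambda>y. fd f y a) (x + s *\<^sub>R a + t *\<^sub>R b) b)"
proof -
  \<comment> \<open>The increment of \<open>f\<close> along the side \<open>h *\<^sub>R b\<close>,
    so that \<open>\<phi> h - \<phi> 0\<close> is the second difference.\<close>
  define \<phi> where "\<phi> s = f (x + s *\<^sub>R a + h *\<^sub>R b) - f (x + s *\<^sub>R a)" for s
  have S0: "x + s *\<^sub>R a \<in> S" if "0 \<le> s" "s \<le> h" for s using S[OF that, of 0] h by simp
  have D1: "(\<phi> has_real_derivative fd f (x + s *\<^sub>R a + h *\<^sub>R b) a - fd f (x + s *\<^sub>R a) a) (at s)"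
    if s: "0 \<le> s" "s \<le> h" for s
  proof -
    have *: "((\<lambda>s. f (x + s *\<^sub>R a + z)) has_derivative (\<lambda>r. fd f (x + s *\<^sub>R a + z) (r *\<^sub>R a))) (at s)"
      if "x + s *\<^sub>R a + z \<in> S" for z
    proof -
      have "((\<lambda>s. x + s *\<^sub>R a + z) has_derivative (\<lambda>r. r *\<^sub>R a)) (at s)"
        by (auto intro!: derivative_eq_intros)
      from has_derivative_compose[OF this, of f "fd f (x + s *\<^sub>R a + z)"]
      show ?thesis using smooth_on_has_derivative[OF f that] by simp
    qed
    have l: "linear (fd f y)" if "y \<in> S" for y using smooth_on_linear_fd[OF f that] .
    have "(\<phi> has_derivative (\<lambda>r. r * fd f (x + s *\<^sub>R a + h *\<^sub>R b) a - r * fd f (x + s *\<^sub>R a) a)) (at s)"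
      using has_derivative_diff[OF *[of "h *\<^sub>R b"] *[of 0]] S[OF s, of h] S0[OF s] h
      by (simp add: linear_scale[OF l] \<phi>_def[abs_def])
    then show ?thesis unfolding has_field_derivative_def
      by (rule has_derivative_eq_rhs) (simp add: fun_eq_iff algebra_simps)
  qed
  obtain s where s: "0 < s" "s < h" and
    e1: "\<phi> h - \<phi> 0 = (h - 0) * (fd f (x + s *\<^sub>R a + h *\<^sub>R b) a - fd f (x + s *\<^sub>R a) a)"
    using MVT2[OF h D1] by blast
  define \<psi> where "\<psi> t = fd f (x + s *\<^sub>R a + t *\<^sub>R b) a" for t
  let ?f' = "\<lambda>y. fd f y a"
  have f': "smooth_on S ?f'" using smooth_on_fd[OF f] .
  have D2: "(\<psi> has_real_derivative fd ?f' (x + s *\<^sub>R a + t *\<^sub>R b) b) (at t)"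
    if t: "0 \<le> t" "t \<le> h" for t
  proof -
    have i: "x + s *\<^sub>R a + t *\<^sub>R b \<in> S" using S s t by simp
    have "((\<lambda>t. x + s *\<^sub>R a + t *\<^sub>R b) has_derivative (\<lambda>r. r *\<^sub>R b)) (at t)"
      by (auto intro!: derivative_eq_intros)
    from has_derivative_compose[OF this, of ?f' "fd ?f' (x + s *\<^sub>R a + t *\<^sub>R b)"]
    have "((\<lambda>t. ?f' (x + s *\<^sub>R a + t *\<^sub>R b)) has_derivative
      (\<lambda>r. fd ?f' (x + s *\<^sub>R a + t *\<^sub>R b) (r *\<^sub>R b))) (at t)"
      using smooth_on_has_derivative[OF f' i] by simp
    then show ?thesis unfolding \<psi>_def has_field_derivative_def
      by (simp add: linear_scale[OF smooth_on_linear_fd[OF f' i]] mult_commute_abs)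
  qed
  obtain t where t: "0 < t" "t < h" and e2: "\<psi> h - \<psi> 0 = (h - 0) * fd ?f' (x + s *\<^sub>R a + t *\<^sub>R b) b"
    using MVT2[OF h D2] by blast
  show ?thesis
    by (rule that[OF s t]) (use e1 e2 in \<open>simp add: \<phi>_def \<psi>_def algebra_simps\<close>)
qed

text \<open>The second difference equals \<open>h * h\<close> times either mixed derivative, each at
  some point of the same small parallelogram. If the two derivatives differed at \<open>x\<close>,
  continuity would keep each within half the gap of its value at \<open>x\<close>, so that they
  could not share a value.\<close>

lemma fd_symmetric_real:
  fixes f :: "'a::real_normed_vector \<Rightarrow> real"
  assumes S: "open S" "x \<in> S" and f: "smooth_on S f"
  shows "fd (\<lambda>y. fd f y a) x b = fd (\<lambda>y. fd f y b) x a"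
proof (rule ccontr)
  define P where "P = (\<lambda>y. fd (\<lambda>y. fd f y a) y b)"
  define Q where "Q = (\<lambda>y. fd (\<lambda>y. fd f y b) y a)"
  assume "\<not> ?thesis"
  then have ne: "0 < \<bar>P x - Q x\<bar>" by (simp add: P_def Q_def)
  have "continuous_on S P" "continuous_on S Q"
    unfolding P_def Q_def by (intro smooth_on_continuous smooth_on_fd f)+
  then have "isCont P x" "isCont Q x" using S continuous_on_eq_continuous_at by blast+
  with ne obtain d1 d2 where d1: "d1 > 0" "\<And>y. dist y x < d1 \<Longrightarrow> dist (P y) (P x) < \<bar>P x - Q x\<bar> / 2"
    and d2: "d2 > 0" "\<And>y. dist y x < d2 \<Longrightarrow> dist (Q y) (Q x) < \<bar>P x - Q x\<bar> / 2"
    unfolding continuous_at_eps_delta by (metis half_gt_zero)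
  obtain d3 where d3: "d3 > 0" "ball x d3 \<subseteq> S" using S open_contains_ball by blast
  define d where "d = min d1 (min d2 d3)"
  have d: "d > 0" using d1 d2 d3 by (simp add: d_def)
  \<comment> \<open>The denominator keeps the whole parallelogram within distance \<open>d\<close>
    of \<open>x\<close>; the summand 1 makes the estimate strict and covers the case of
    \<open>a\<close> and \<open>b\<close> both zero.\<close>
  define h where "h = d / (norm a + norm b + 1)"
  have n: "norm a + norm b + 1 > 0" by (smt (verit) norm_ge_zero)
  then have h: "h > 0" using d by (simp add: h_def)
  have near: "dist (x + s *\<^sub>R a + t *\<^sub>R b) x < d" if "0 \<le> s" "s \<le> h" "0 \<le> t" "t \<le> h" for s t
  proof -
    have "dist (x + s *\<^sub>R a + t *\<^sub>R b) x \<le> s * norm a + t * norm b"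
      using that norm_triangle_ineq[of "s *\<^sub>R a" "t *\<^sub>R b"] by (simp add: dist_norm)
    also have "\<dots> \<le> h * norm a + h * norm b" using that by (intro add_mono mult_right_mono) auto
    also have "\<dots> < h * (norm a + norm b + 1)" using h by (simp add: algebra_simps)
    also have "\<dots> = d" using n by (simp add: h_def)
    finally show ?thesis .
  qed
  have in1: "x + s *\<^sub>R a + t *\<^sub>R b \<in> S" if "0 \<le> s" "s \<le> h" "0 \<le> t" "t \<le> h" for s t
    using near[OF that] d3 by (auto simp: d_def subset_iff dist_commute)
  have in2: "x + t *\<^sub>R b + s *\<^sub>R a \<in> S" if "0 \<le> t" "t \<le> h" "0 \<le> s" "s \<le> h" for s t
    using in1[OF that(3,4,1,2)] by (simp add: algebra_simps)
  obtain s t where st: "0 < s" "s < h" "0 < t" "t < h"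
    and e1: "f (x + h *\<^sub>R a + h *\<^sub>R b) - f (x + h *\<^sub>R a) - f (x + h *\<^sub>R b) + f x
      = h * (h * P (x + s *\<^sub>R a + t *\<^sub>R b))"
    using mixed_difference[OF f h in1] unfolding P_def by blast
  obtain s' t' where st': "0 < s'" "s' < h" "0 < t'" "t' < h"
    and e2: "f (x + h *\<^sub>R b + h *\<^sub>R a) - f (x + h *\<^sub>R b) - f (x + h *\<^sub>R a) + f x
      = h * (h * Q (x + t' *\<^sub>R b + s' *\<^sub>R a))"
    using mixed_difference[OF f h in2] unfolding Q_def by blast
  have "h * (h * P (x + s *\<^sub>R a + t *\<^sub>R b)) = h * (h * Q (x + t' *\<^sub>R b + s' *\<^sub>R a))"
    using e1 e2 by (simp add: algebra_simps)
  then have "P (x + s *\<^sub>R a + t *\<^sub>R b) = Q (x + s' *\<^sub>R a + t' *\<^sub>R b)"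
    using h by (simp add: algebra_simps)
  moreover have "dist (x + s *\<^sub>R a + t *\<^sub>R b) x < d1" "dist (x + s' *\<^sub>R a + t' *\<^sub>R b) x < d2"
    using near[of s t] near[of s' t'] st st' by (auto simp: d_def)
  ultimately show False using d1(2) d2(2) unfolding dist_real_def by (smt (verit) field_sum_of_halves)
qed

text \<open>Inner products with basis vectors commute with differentiation, which reduces the claim
  to real components.\<close>

lemma fd_symmetric:
  fixes f :: "'a::real_normed_vector \<Rightarrow> 'b::euclidean_space"
  assumes S: "open S" "x \<in> S" and f: "smooth_on S f"
  shows "fd (\<lambda>y. fd f y a) x b = fd (\<lambda>y. fd f y b) x a"
proof (rule euclidean_eqI)
  fix i :: 'b
  have D: "fd (\<lambda>y. h y \<bullet> i) y = (\<lambda>v. fd h y v \<bullet> i)" if "smooth_on S h" "y \<in> S" for h :: "'a \<Rightarrow> 'b" and y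
    using fd_eqI[OF bounded_linear.has_derivative[OF bounded_linear_inner_left smooth_on_has_derivative[OF that]]] .
  have *: "fd (\<lambda>y. fd f y a) x b \<bullet> i = fd (\<lambda>y. fd (\<lambda>y. f y \<bullet> i) y a) x b" for a b
  proof -
    have "fd (\<lambda>y. fd f y a) x b \<bullet> i = fd (\<lambda>y. fd f y a \<bullet> i) x b"
      using D[OF smooth_on_fd[OF f] S(2), of a] by simp
    also have "fd (\<lambda>y. fd f y a \<bullet> i) x = fd (\<lambda>y. fd (\<lambda>y. f y \<bullet> i) y a) x"
    proof (rule fd_cong(1)[OF S])
      show "fd f y a \<bullet> i = fd (\<lambda>y. f y \<bullet> i) y a" if "y \<in> S" for y using D[OF f that] by simp
      show "(\<lambda>y. fd f y a \<bullet> i) differentiable (at x)"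
        by (rule smooth_on_differentiable[OF smooth_on_bounded_linear[OF bounded_linear_inner_left S(1)] S(2)])
          (rule smooth_on_fd[OF f])
    qed
    finally show ?thesis .
  qed
  show "fd (\<lambda>y. fd f y a) x b \<bullet> i = fd (\<lambda>y. fd f y b) x a \<bullet> i"
    unfolding * by (rule fd_symmetric_real[OF S smooth_on_bounded_linear[OF bounded_linear_inner_left S(1) f]])
qed


section \<open>Brackets of vector fields in coordinates\<close>

text \<open>The Lie bracket of fields given by their components in one fixed chart, with the sign
  convention of \<open>lie_bracket\<close>.\<close>

definition bracket :: "('a::real_normed_vector \<Rightarrow> 'a) \<Rightarrow> ('a \<Rightarrow> 'a) \<Rightarrow> 'a \<Rightarrow> 'a" where
  "bracket X Y x = fd Y x (X x) - fd X x (Y x)"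

lemma smooth_on_bracket:
  fixes X Y :: "'a::euclidean_space \<Rightarrow> 'a"
  shows "open S \<Longrightarrow> smooth_on S X \<Longrightarrow> smooth_on S Y \<Longrightarrow> smooth_on S (bracket X Y)"
  unfolding bracket_def[abs_def] by (intro smooth_on_diff smooth_on_fd_apply)

lemma bracket_cong:
  assumes "open S" "x \<in> S" "\<And>y. y \<in> S \<Longrightarrow> X y = X' y" "\<And>y. y \<in> S \<Longrightarrow> Y y = Y' y"
    "X differentiable (at x)" "Y differentiable (at x)"
  shows "bracket X Y x = bracket X' Y' x"
  using fd_cong(1)[OF assms(1,2,3,5)] fd_cong(1)[OF assms(1,2,4,6)] assms by (simp add: bracket_def)

text \<open>The product rule for a derivative applied to a moving vector. The second derivative of
  \<open>f\<close> appears as the derivative of \<open>fd f y v\<close> with \<open>v\<close> frozen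
  at \<open>h x\<close>, which avoids calculus in a space of linear maps.\<close>

lemma has_derivative_fd_apply:
  fixes f :: "'a::euclidean_space \<Rightarrow> 'b::real_normed_vector"
  assumes S: "open S" "x \<in> S" and f: "smooth_on S f" and h: "smooth_on S h"
  shows "((\<lambda>y. fd f y (h y)) has_derivative (\<lambda>a. fd (\<lambda>y. fd f y (h x)) x a + fd f x (fd h x a))) (at x)"
proof -
  let ?s = "\<lambda>y. \<Sum>i\<in>Basis. (h y \<bullet> i) *\<^sub>R fd f y i"
  let ?s' = "\<lambda>a. \<Sum>i\<in>Basis. (h x \<bullet> i) *\<^sub>R fd (\<lambda>y. fd f y i) x a + (fd h x a \<bullet> i) *\<^sub>R fd f x i"
  have eq: "fd f y v = (\<Sum>i\<in>Basis. (v \<bullet> i) *\<^sub>R fd f y i)" if "y \<in> S" for y v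
    using fd_euclidean_sum smooth_on_differentiable[OF f that] by blast
  have d: "((\<lambda>y. fd f y v) has_derivative fd (\<lambda>y. fd f y v) x) (at x)" for v
    using smooth_on_has_derivative[OF smooth_on_fd[OF f] S(2)] .
  have "(?s has_derivative ?s') (at x)"
    by (intro has_derivative_sum has_derivative_scaleR d has_derivative_inner_left
        smooth_on_has_derivative[OF h S(2)])
  then have 1: "((\<lambda>y. fd f y (h y)) has_derivative ?s') (at x)"
    by (rule has_derivative_transform_within_open[OF _ S]) (rule eq[symmetric])
  \<comment> \<open>The same expansion with a constant direction \<open>v\<close> identifies the
    first half of \<open>?s'\<close> as a second derivative of \<open>f\<close>.\<close>
  have "((\<lambda>y. \<Sum>i\<in>Basis. (v \<bullet> i) *\<^sub>R fd f y i) has_derivative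
      (\<lambda>a. \<Sum>i\<in>Basis. (v \<bullet> i) *\<^sub>R fd (\<lambda>y. fd f y i) x a)) (at x)" for v
    by (intro has_derivative_sum has_derivative_scaleR_right d)
  then have "((\<lambda>y. fd f y v) has_derivative
      (\<lambda>a. \<Sum>i\<in>Basis. (v \<bullet> i) *\<^sub>R fd (\<lambda>y. fd f y i) x a)) (at x)" for v
    by (rule has_derivative_transform_within_open[OF _ S]) (rule eq[symmetric])
  then have 2: "fd (\<lambda>y. fd f y v) x a = (\<Sum>i\<in>Basis. (v \<bullet> i) *\<^sub>R fd (\<lambda>y. fd f y i) x a)" for v a
    by (rule fd_eqI[THEN fun_cong])
  have "?s' = (\<lambda>a. fd (\<lambda>y. fd f y (h x)) x a + fd f x (fd h x a))"
    by (simp only: sum.distrib 2[symmetric] eq[OF S(2), symmetric])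
  with 1 show ?thesis by simp
qed

text \<open>Differentiating the relation between \<open>Z'\<close> and \<open>Z\<close> gives a term
  with the second derivative of \<open>f\<close> and the image of \<open>fd Z x\<close>. In the
  difference that forms the bracket the second derivatives cancel by symmetry. With \<open>f\<close>
  a change of charts this makes the bracket independent of the chart.\<close>

lemma bracket_related:
  fixes f :: "'a::euclidean_space \<Rightarrow> 'b::euclidean_space"
  assumes S: "open S" "x \<in> S" and f: "smooth_on S f"
    and X: "smooth_on S X" and Y: "smooth_on S Y"
    and X': "X' differentiable (at (f x))" and Y': "Y' differentiable (at (f x))"
    and rel: "\<And>y. y \<in> S \<Longrightarrow> X' (f y) = fd f y (X y)" "\<And>y. y \<in> S \<Longrightarrow> Y' (f y) = fd f y (Y y)"
  shows "bracket X' Y' (f x) = fd f x (bracket X Y x)"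
proof -
  have *: "fd Z' (f x) (fd f x a) = fd (\<lambda>y. fd f y (Z x)) x a + fd f x (fd Z x a)"
    if Z: "smooth_on S Z" "Z' differentiable (at (f x))" "\<And>y. y \<in> S \<Longrightarrow> Z' (f y) = fd f y (Z y)"
    for Z :: "'a \<Rightarrow> 'a" and Z' a
  proof -
    have "((\<lambda>y. Z' (f y)) has_derivative (\<lambda>a. fd Z' (f x) (fd f x a))) (at x)"
      using has_derivative_compose[OF smooth_on_has_derivative[OF f S(2)]] Z(2)
      by (metis frechet_derivative_works)
    then have "((\<lambda>y. fd f y (Z y)) has_derivative (\<lambda>a. fd Z' (f x) (fd f x a))) (at x)"
      by (rule has_derivative_transform_within_open[OF _ S]) (rule Z(3))
    from has_derivative_unique[OF this has_derivative_fd_apply[OF S f Z(1)]]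
    show ?thesis by (rule fun_cong)
  qed
  show ?thesis
    using rel[OF S(2)] *[OF X X' rel(1)] *[OF Y Y' rel(2)] fd_symmetric[OF S f, of "X x" "Y x"]
    by (simp add: bracket_def linear_diff[OF smooth_on_linear_fd[OF f S(2)]])
qed

lemma fd_bracket:
  fixes X Y :: "'a::euclidean_space \<Rightarrow> 'a"
  assumes S: "open S" "x \<in> S" and X: "smooth_on S X" and Y: "smooth_on S Y"
  shows "fd (bracket X Y) x a = (fd (\<lambda>y. fd Y y (X x)) x a + fd Y x (fd X x a))
    - (fd (\<lambda>y. fd X y (Y x)) x a + fd X x (fd Y x a))"
  using fd_eqI[OF has_derivative_diff[OF has_derivative_fd_apply[OF S Y X] has_derivative_fd_apply[OF S X Y]]]
  by (simp add: bracket_def[abs_def])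

text \<open>Once symmetry allows their arguments to be swapped, the second derivatives occur in
  pairs of opposite sign; the products of first derivatives cancel identically.\<close>

lemma bracket_jacobi:
  fixes X Y Z :: "'a::euclidean_space \<Rightarrow> 'a"
  assumes S: "open S" "x \<in> S" and X: "smooth_on S X" and Y: "smooth_on S Y" and Z: "smooth_on S Z"
  shows "bracket (bracket X Y) Z x + bracket (bracket Y Z) X x + bracket (bracket Z X) Y x = 0"
  using fd_symmetric[OF S X, of "Y x" "Z x"] fd_symmetric[OF S Y, of "X x" "Z x"]
    fd_symmetric[OF S Z, of "X x" "Y x"]
  by (simp add: bracket_def[of "bracket _ _"] fd_bracket[OF S X Y] fd_bracket[OF S Y Z] fd_bracket[OF S Z X])
    (simp add: bracket_def linear_diff[OF smooth_on_linear_fd[OF X S(2)]]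
      linear_diff[OF smooth_on_linear_fd[OF Y S(2)]] linear_diff[OF smooth_on_linear_fd[OF Z S(2)]])

text \<open>The product rule for a function that is identically zero: one term differentiates the
  form with the vector frozen, the other applies the form to the derivative of the pushed-forward
  field.\<close>

lemma pullback_derivative:
  fixes f :: "'a::euclidean_space \<Rightarrow> 'b::euclidean_space" and \<alpha> :: "'b \<Rightarrow> 'b \<Rightarrow> real"
  assumes S: "open S" "x \<in> S" and f: "smooth_on S f" and Y: "smooth_on S Y"
    and lin: "\<And>y. y \<in> S \<Longrightarrow> linear (\<alpha> (f y))"
    and \<alpha>: "\<And>v. (\<lambda>z. \<alpha> z v) differentiable (at (f x))"
    and zero: "\<And>y. y \<in> S \<Longrightarrow> \<alpha> (f y) (fd f y (Y y)) = 0"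
  shows "fd (\<lambda>z. \<alpha> z (fd f x (Y x))) (f x) (fd f x a)
    + \<alpha> (f x) (fd (\<lambda>y. fd f y (Y x)) x a + fd f x (fd Y x a)) = 0"
proof -
  define h where "h y = fd f y (Y y)" for y
  define h' where "h' a = fd (\<lambda>y. fd f y (Y x)) x a + fd f x (fd Y x a)" for a
  have dh: "(h has_derivative h') (at x)"
    unfolding h_def[abs_def] h'_def[abs_def] by (rule has_derivative_fd_apply[OF S f Y])
  have d\<alpha>: "((\<lambda>z. \<alpha> z v) has_derivative fd (\<lambda>z. \<alpha> z v) (f x)) (at (f x))" for v
    using \<alpha> frechet_derivative_works by blast
  let ?s = "\<lambda>y. \<Sum>i\<in>Basis. (h y \<bullet> i) *\<^sub>R \<alpha> (f y) i"
  let ?s' = "\<lambda>a. \<Sum>i\<in>Basis. (h x \<bullet> i) *\<^sub>R fd (\<lambda>z. \<alpha> z i) (f x) (fd f x a) + (h' a \<bullet> i) *\<^sub>R \<alpha> (f x) i"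
  have d: "((\<lambda>y. \<alpha> (f y) v) has_derivative (\<lambda>a. fd (\<lambda>z. \<alpha> z v) (f x) (fd f x a))) (at x)" for v
    using has_derivative_compose[OF smooth_on_has_derivative[OF f S(2)] d\<alpha>] .
  have 1: "(?s has_derivative ?s') (at x)"
    by (intro has_derivative_sum has_derivative_scaleR d has_derivative_inner_left dh)
  have eq: "\<alpha> (f y) v = (\<Sum>i\<in>Basis. (v \<bullet> i) *\<^sub>R \<alpha> (f y) i)" if "y \<in> S" for y v
  proof -
    have "\<alpha> (f y) v = \<alpha> (f y) (\<Sum>i\<in>Basis. (v \<bullet> i) *\<^sub>R i)" by (simp add: euclidean_representation)
    then show ?thesis by (simp add: linear_sum[OF lin[OF that]] linear_scale[OF lin[OF that]])
  qed
  have "?s y = 0" if "y \<in> S" for y using zero[OF that] eq[OF that, of "h y"] by (simp add: h_def)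
  then have "((\<lambda>y. 0) has_derivative ?s') (at x)"
    by (rule has_derivative_transform_within_open[OF 1 S])
  from has_derivative_unique[OF this has_derivative_const] have 2: "?s' a = 0" by (rule fun_cong)
  \<comment> \<open>\<open>\<alpha> z\<close> is linear only for \<open>z\<close> in the image of \<open>f\<close>, hence the detour through \<open>\<alpha> \<circ> f\<close>.\<close>
  have "((\<lambda>y. \<Sum>i\<in>Basis. (v \<bullet> i) *\<^sub>R \<alpha> (f y) i) has_derivative
      (\<lambda>a. \<Sum>i\<in>Basis. (v \<bullet> i) *\<^sub>R fd (\<lambda>z. \<alpha> z i) (f x) (fd f x a))) (at x)" for v
    by (intro has_derivative_sum has_derivative_scaleR_right d)
  then have "((\<lambda>y. \<alpha> (f y) v) has_derivative
      (\<lambda>a. \<Sum>i\<in>Basis. (v \<bullet> i) *\<^sub>R fd (\<lambda>z. \<alpha> z i) (f x) (fd f x a))) (at x)" for v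
    by (rule has_derivative_transform_within_open[OF _ S]) (rule eq[symmetric])
  from has_derivative_unique[OF d this]
  have 3: "fd (\<lambda>z. \<alpha> z v) (f x) (fd f x a) = (\<Sum>i\<in>Basis. (v \<bullet> i) *\<^sub>R fd (\<lambda>z. \<alpha> z i) (f x) (fd f x a))"
    for v by (rule fun_cong)
  show ?thesis
    using 2 unfolding sum.distrib 3[symmetric] eq[OF S(2), symmetric] by (simp add: h_def h'_def)
qed

text \<open>Subtracting the two instances of \<open>pullback_derivative\<close> leaves the bracket,
  because the second derivatives of \<open>f\<close> are symmetric. The right-hand side is minus the
  usual (not halved) exterior derivative of \<open>\<alpha>\<close> on constant fields, so this is
  the compatibility of d with pull-back on fields annihilated by the pulled back form.\<close>

lemma pullback_bracket:
  fixes f :: "'a::euclidean_space \<Rightarrow> 'b::euclidean_space" and \<alpha> :: "'b \<Rightarrow> 'b \<Rightarrow> real"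
  assumes S: "open S" "x \<in> S" and f: "smooth_on S f" and X: "smooth_on S X" and Y: "smooth_on S Y"
    and lin: "\<And>y. y \<in> S \<Longrightarrow> linear (\<alpha> (f y))"
    and \<alpha>: "\<And>v. (\<lambda>z. \<alpha> z v) differentiable (at (f x))"
    and zero: "\<And>y. y \<in> S \<Longrightarrow> \<alpha> (f y) (fd f y (X y)) = 0" "\<And>y. y \<in> S \<Longrightarrow> \<alpha> (f y) (fd f y (Y y)) = 0"
  shows "\<alpha> (f x) (fd f x (bracket X Y x)) =
    fd (\<lambda>z. \<alpha> z (fd f x (X x))) (f x) (fd f x (Y x)) - fd (\<lambda>z. \<alpha> z (fd f x (Y x))) (f x) (fd f x (X x))"
  using pullback_derivative[OF S f X lin \<alpha> zero(1), of "Y x"]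
    pullback_derivative[OF S f Y lin \<alpha> zero(2), of "X x"] fd_symmetric[OF S f, of "X x" "Y x"]
  by (simp add: bracket_def linear_diff[OF smooth_on_linear_fd[OF f S(2)]] linear_diff[OF lin[OF S(2)]]
      linear_add[OF lin[OF S(2)]])

section \<open>Vector fields on complex manifolds\<close>

context
  fixes A :: "('p::topological_space, 'n::finite) chart set"
  assumes A: "complex_atlas A"
begin

section \<open>Charts, transition maps and components of tangent vectors\<close>

lemma chart_at_in: "chart_at A p \<in> A" "p \<in> fst (chart_at A p)"
proof -
  have "\<exists>c. c \<in> A \<and> p \<in> fst c" using A unfolding complex_atlas_def by blast
  then have "chart_at A p \<in> A \<and> p \<in> fst (chart_at A p)" unfolding chart_at_def by (rule someI_ex)
  then show "chart_at A p \<in> A" "p \<in> fst (chart_at A p)" by auto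
qed

lemma chart_homeomorphism:
  "c \<in> A \<Longrightarrow> homeomorphism (fst c) (snd c ` fst c) (snd c) (chart_inv c)"
  using A unfolding complex_atlas_def by blast

lemma open_chart_domain: "c \<in> A \<Longrightarrow> open (fst c)"
  using A unfolding complex_atlas_def by blast

lemma chart_inv_chart: "c \<in> A \<Longrightarrow> p \<in> fst c \<Longrightarrow> chart_inv c (snd c p) = p"
  using chart_homeomorphism homeomorphism_apply1 by blast

lemma in_chart_image:
  assumes "c \<in> A" "x \<in> snd c ` (fst c \<inter> W)"
  shows "chart_inv c x \<in> fst c" "chart_inv c x \<in> W" "snd c (chart_inv c x) = x"
  using assms chart_inv_chart by auto

lemma open_chart_image:
  assumes c: "c \<in> A" and W: "open W"
  shows "open (snd c ` (fst c \<inter> W))"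
proof -
  have "open (snd c ` fst c)" using A c unfolding complex_atlas_def by blast
  moreover have "openin (top_of_set (snd c ` fst c)) (snd c ` (fst c \<inter> W))"
    using homeomorphism_imp_open_map[OF chart_homeomorphism[OF c]] W by blast
  ultimately show ?thesis using openin_open_eq by blast
qed

lemma transition_hol:
  "b \<in> A \<Longrightarrow> c \<in> A \<Longrightarrow> hol_map_on (snd b ` (fst b \<inter> fst c)) (snd c \<circ> chart_inv b)"
  using A unfolding complex_atlas_def by blast

lemma transition_smooth:
  "b \<in> A \<Longrightarrow> c \<in> A \<Longrightarrow> smooth_on (snd b ` (fst b \<inter> fst c)) (snd c \<circ> chart_inv b)"
  using transition_hol unfolding hol_map_on_def by blast

text \<open>The chain rule, for an identity of transition maps that is guaranteed only on the image
  \<open>?S\<close> of the triple overlap.\<close>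

lemma transition_cocycle:
  assumes a: "a \<in> A" "p \<in> fst a" and b: "b \<in> A" "p \<in> fst b" and c: "c \<in> A" "p \<in> fst c"
  shows "fd (snd c \<circ> chart_inv b) (snd b p) (fd (snd b \<circ> chart_inv a) (snd a p) w)
    = fd (snd c \<circ> chart_inv a) (snd a p) w"
proof -
  let ?S = "snd a ` (fst a \<inter> (fst b \<inter> fst c))"
  have S: "open ?S" "snd a p \<in> ?S"
    using open_chart_image[OF a(1) open_Int[OF open_chart_domain[OF b(1)] open_chart_domain[OF c(1)]]] b c a
    by auto
  have "((snd b \<circ> chart_inv a) has_derivative fd (snd b \<circ> chart_inv a) (snd a p)) (at (snd a p))"
    using smooth_on_has_derivative[OF transition_smooth[OF a(1) b(1)]] a b by blast
  moreover have "((snd c \<circ> chart_inv b) has_derivative fd (snd c \<circ> chart_inv b) (snd b p))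
      (at ((snd b \<circ> chart_inv a) (snd a p)))"
    using smooth_on_has_derivative[OF transition_smooth[OF b(1) c(1)], of "snd b p"] a b c
    by (simp add: chart_inv_chart)
  ultimately have "((\<lambda>x. (snd c \<circ> chart_inv b) ((snd b \<circ> chart_inv a) x)) has_derivative
      (\<lambda>w. fd (snd c \<circ> chart_inv b) (snd b p) (fd (snd b \<circ> chart_inv a) (snd a p) w))) (at (snd a p))"
    by (rule has_derivative_compose)
  then have "((snd c \<circ> chart_inv a) has_derivative
      (\<lambda>w. fd (snd c \<circ> chart_inv b) (snd b p) (fd (snd b \<circ> chart_inv a) (snd a p) w))) (at (snd a p))"
    by (rule has_derivative_transform_within_open[OF _ S]) (auto simp: chart_inv_chart a b)
  from fd_eqI[OF this] show ?thesis by simp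
qed

lemma transition_self:
  assumes "c \<in> A" "p \<in> fst c"
  shows "fd (snd c \<circ> chart_inv c) (snd c p) w = w"
proof -
  have S: "open (snd c ` (fst c \<inter> UNIV))" "snd c p \<in> snd c ` (fst c \<inter> UNIV)"
    using open_chart_image[OF assms(1) open_UNIV] assms by auto
  have "((\<lambda>x. x) has_derivative (\<lambda>w. w)) (at (snd c p))" by simp
  then have "((snd c \<circ> chart_inv c) has_derivative (\<lambda>w. w)) (at (snd c p))"
    by (rule has_derivative_transform_within_open[OF _ S]) (auto simp: chart_inv_chart assms)
  from fd_eqI[OF this] show ?thesis by simp
qed

lemma coord_self: "coord A (chart_at A p) p w = w"
  unfolding coord_def using transition_self chart_at_in by blast

lemma coord_change:
  assumes "b \<in> A" "p \<in> fst b" "c \<in> A" "p \<in> fst c"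
  shows "coord A c p w = fd (snd c \<circ> chart_inv b) (snd b p) (coord A b p w)"
  unfolding coord_def using transition_cocycle[OF chart_at_in assms] by simp

lemma linear_transition:
  "b \<in> A \<Longrightarrow> c \<in> A \<Longrightarrow> p \<in> fst b \<Longrightarrow> p \<in> fst c \<Longrightarrow> linear (fd (snd c \<circ> chart_inv b) (snd b p))"
  using smooth_on_linear_fd[OF transition_smooth] by blast

text \<open>Complex linearity of the transition derivatives is what makes multiplication by
  \<open>\<i>\<close> independent of the chart.\<close>

lemma coord_J:
  assumes "c \<in> A" "p \<in> fst c"
  shows "coord A c p (J w) = J (coord A c p w)"
  using transition_hol[OF chart_at_in(1) assms(1)] chart_at_in(2) assms
  unfolding hol_map_on_def J_def coord_def by blast

text \<open>The coordinate field with constant components \<open>a\<close> in the chart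
  \<open>c\<close>, rewritten in the chart chosen at \<open>p\<close> because tangent vectors are
  stored that way. Such fields take prescribed values at a point and commute with each
  other.\<close>

definition chart_field :: "('p, 'n) chart \<Rightarrow> complex ^ 'n \<Rightarrow> 'p \<Rightarrow> complex ^ 'n" where
  "chart_field c a p = fd (snd (chart_at A p) \<circ> chart_inv c) (snd c p) a"

lemma coord_chart_field:
  assumes "c \<in> A" "p \<in> fst c"
  shows "coord A c p (chart_field c a p) = a"
  unfolding coord_def chart_field_def
  using transition_cocycle[OF assms chart_at_in assms] transition_self[OF assms] by simp

lemma chart_field_coord:
  assumes "c \<in> A" "p \<in> fst c"
  shows "chart_field c (coord A c p w) p = w"
  unfolding coord_def chart_field_def
  using transition_cocycle[OF chart_at_in assms chart_at_in] transition_self[OF chart_at_in] by simp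

lemma linear_chart_field:
  assumes "c \<in> A" "p \<in> fst c"
  shows "linear (\<lambda>a. chart_field c a p)"
  unfolding chart_field_def using linear_transition[OF assms(1) chart_at_in(1) assms(2) chart_at_in(2)] .

lemma vf_rep_chart_field: "c \<in> A \<Longrightarrow> x \<in> snd c ` fst c \<Longrightarrow> vf_rep A c (chart_field c a) x = a"
  using in_chart_image[of c x UNIV] coord_chart_field unfolding vf_rep_def by auto

lemma smooth_vf_chart_field:
  assumes c: "c \<in> A" and W: "open W" "W \<subseteq> fst c"
  shows "smooth_vf A W (chart_field c a)"
  unfolding smooth_vf_def
proof
  fix b assume b: "b \<in> A"
  let ?S = "snd b ` (fst b \<inter> W)"
  have S: "open ?S" using open_chart_image[OF b W(1)] .
  have "smooth_on ?S (\<lambda>x. fd (snd b \<circ> chart_inv c) ((snd c \<circ> chart_inv b) x) a)"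
  proof (rule smooth_on_compose[OF S, where f = "snd c \<circ> chart_inv b" and g = "\<lambda>x. fd (snd b \<circ> chart_inv c) x a"])
    show "smooth_on ?S (snd c \<circ> chart_inv b)"
      by (rule smooth_on_subset[OF transition_smooth[OF b c]]) (use W in auto)
    show "smooth_on (snd c ` (fst c \<inter> fst b)) (\<lambda>x. fd (snd b \<circ> chart_inv c) x a)"
      using smooth_on_fd transition_smooth[OF c b] by blast
    show "(snd c \<circ> chart_inv b) ` ?S \<subseteq> snd c ` (fst c \<inter> fst b)"
      using W in_chart_image[OF b] by fastforce
  qed
  then show "smooth_on ?S (vf_rep A b (chart_field c a))"
  proof (rule smooth_on_cong[OF S, rotated])
    fix x assume x: "x \<in> ?S"
    note p = in_chart_image[OF b x]
    have "chart_inv b x \<in> fst c" using p W by blast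
    with p show "fd (snd b \<circ> chart_inv c) ((snd c \<circ> chart_inv b) x) a = vf_rep A b (chart_field c a) x"
      unfolding vf_rep_def using coord_change[OF c _ b p(1)] coord_chart_field[OF c] by simp
  qed
qed

section \<open>Vector fields and their Lie brackets read in a fixed chart\<close>

lemma vf_rep_transition:
  assumes b: "b \<in> A" and c: "c \<in> A" and x: "x \<in> snd b ` (fst b \<inter> fst c)"
  shows "vf_rep A c X ((snd c \<circ> chart_inv b) x) = fd (snd c \<circ> chart_inv b) x (vf_rep A b X x)"
  using in_chart_image[OF b x] coord_change[OF b _ c] chart_inv_chart[OF c] unfolding vf_rep_def by simp

lemma vf_rep_at_chart: "c \<in> A \<Longrightarrow> p \<in> fst c \<Longrightarrow> vf_rep A c X (snd c p) = coord A c p (X p)"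
  by (simp add: vf_rep_def chart_inv_chart)

lemma smooth_vf_subset: "smooth_vf A W X \<Longrightarrow> W' \<subseteq> W \<Longrightarrow> smooth_vf A W' X"
  unfolding smooth_vf_def by (meson Int_mono image_mono order_refl smooth_on_subset)

lemma smooth_vf_rep: "smooth_vf A W X \<Longrightarrow> c \<in> A \<Longrightarrow> smooth_on (snd c ` (fst c \<inter> W)) (vf_rep A c X)"
  unfolding smooth_vf_def by blast

lemma lie_bracket_eq:
  "lie_bracket A X Y p =
    bracket (vf_rep A (chart_at A p) X) (vf_rep A (chart_at A p) Y) (snd (chart_at A p) p)"
  by (simp add: lie_bracket_def Let_def bracket_def vf_rep_at_chart chart_at_in coord_self)

text \<open>At each point \<open>lie_bracket\<close> uses the chart chosen there, which may jump
  from point to point. The representations in two charts are related by the transition map, so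
  \<open>bracket_related\<close> gives the bracket in the fixed chart \<open>c\<close>; smoothness
  and the Jacobi identity rest on this.\<close>

lemma vf_rep_lie_bracket:
  assumes W: "open W" and X: "smooth_vf A W X" and Y: "smooth_vf A W Y"
    and c: "c \<in> A" and x: "x \<in> snd c ` (fst c \<inter> W)"
  shows "vf_rep A c (lie_bracket A X Y) x = bracket (vf_rep A c X) (vf_rep A c Y) x"
proof -
  define p where "p = chart_inv c x"
  note p = in_chart_image[OF c x, folded p_def]
  define b where "b = chart_at A p"
  have b: "b \<in> A" "p \<in> fst b" using chart_at_in b_def by auto
  let ?f = "snd c \<circ> chart_inv b"
  let ?S = "snd b ` (fst b \<inter> (fst c \<inter> W))"
  have fp: "?f (snd b p) = x" using p b by (simp add: chart_inv_chart)
  have sub: "smooth_on ?S (vf_rep A b Z)" if "smooth_vf A W Z" for Z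
    by (rule smooth_on_subset[OF smooth_vf_rep[OF that b(1)]]) auto
  have d: "vf_rep A c Z differentiable (at (?f (snd b p)))" if "smooth_vf A W Z" for Z
    unfolding fp using smooth_on_differentiable[OF smooth_vf_rep[OF that c] x] .
  have "bracket (vf_rep A c X) (vf_rep A c Y) (?f (snd b p))
      = fd ?f (snd b p) (bracket (vf_rep A b X) (vf_rep A b Y) (snd b p))"
  proof (rule bracket_related[where S = ?S])
    show "open ?S" using open_chart_image[OF b(1)] open_chart_domain[OF c] W by blast
    show "snd b p \<in> ?S" using b p by blast
    show "smooth_on ?S ?f" by (rule smooth_on_subset[OF transition_smooth[OF b(1) c]]) auto
  qed (use sub X Y d vf_rep_transition[OF b(1) c] in blast)+
  also have "bracket (vf_rep A b X) (vf_rep A b Y) (snd b p) = lie_bracket A X Y p"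
    unfolding b_def lie_bracket_eq ..
  finally have "fd ?f (snd b p) (lie_bracket A X Y p) = bracket (vf_rep A c X) (vf_rep A c Y) x"
    unfolding fp by (rule sym)
  then show ?thesis
    unfolding vf_rep_def[of A c "lie_bracket A X Y"] p_def[symmetric] coord_def b_def[symmetric] .
qed

lemma smooth_vf_lie_bracket:
  assumes W: "open W" and X: "smooth_vf A W X" and Y: "smooth_vf A W Y"
  shows "smooth_vf A W (lie_bracket A X Y)"
  unfolding smooth_vf_def
proof
  fix c assume c: "c \<in> A"
  show "smooth_on (snd c ` (fst c \<inter> W)) (vf_rep A c (lie_bracket A X Y))"
    by (rule smooth_on_cong[OF open_chart_image[OF c W] vf_rep_lie_bracket[OF W X Y c, symmetric]])
      (auto intro!: smooth_on_bracket open_chart_image c W smooth_vf_rep X Y)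
qed

text \<open>The outer bracket differentiates the inner one, so the inner bracket is needed in the
  one chart \<open>c\<close> on a whole neighbourhood of \<open>p\<close>, not just at
  \<open>p\<close>.\<close>

lemma lie_bracket_jacobi:
  assumes W: "open W" "p \<in> W" and X: "smooth_vf A W X" and Y: "smooth_vf A W Y" and Z: "smooth_vf A W Z"
  shows "lie_bracket A (lie_bracket A X Y) Z p + lie_bracket A (lie_bracket A Y Z) X p
    + lie_bracket A (lie_bracket A Z X) Y p = 0"
proof -
  define c where "c = chart_at A p"
  have c: "c \<in> A" "p \<in> fst c" using chart_at_in c_def by auto
  let ?S = "snd c ` (fst c \<inter> W)"
  have S: "open ?S" "snd c p \<in> ?S" using open_chart_image[OF c(1) W(1)] c W by auto
  have *: "lie_bracket A (lie_bracket A P Q) R p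
      = bracket (bracket (vf_rep A c P) (vf_rep A c Q)) (vf_rep A c R) (snd c p)"
    if "smooth_vf A W P" "smooth_vf A W Q" "smooth_vf A W R" for P Q R
    unfolding lie_bracket_eq[of "lie_bracket A P Q"] c_def[symmetric]
    by (rule bracket_cong[OF S vf_rep_lie_bracket[OF W(1) that(1,2) c(1)]])
      (use smooth_on_differentiable[OF smooth_vf_rep[OF _ c(1)] S(2)] smooth_vf_lie_bracket[OF W(1)] that in auto)
  show ?thesis
    using *[OF X Y Z] *[OF Y Z X] *[OF Z X Y]
      bracket_jacobi[OF S smooth_vf_rep[OF X c(1)] smooth_vf_rep[OF Y c(1)] smooth_vf_rep[OF Z c(1)]] by simp
qed

text \<open>Smoothness is postulated for \<open>u\<close> but has to be derived for
  \<open>v\<close>, which is \<open>u\<close> composed with \<open>J\<close>.\<close>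

lemma smooth_vf_J:
  assumes W: "open W" and X: "smooth_vf A W X"
  shows "smooth_vf A W (\<lambda>p. J (X p))"
  unfolding smooth_vf_def
proof
  fix c assume c: "c \<in> A"
  let ?S = "snd c ` (fst c \<inter> W)"
  have S: "open ?S" using open_chart_image[OF c W] .
  have "linear (J :: complex ^ 'n \<Rightarrow> complex ^ 'n)"
    by (rule linearI) (simp_all add: J_def vec_eq_iff algebra_simps)
  then have "smooth_on ?S (\<lambda>x. J (vf_rep A c X x))"
    using smooth_on_bounded_linear[OF _ S smooth_vf_rep[OF X c]] linear_conv_bounded_linear by blast
  then show "smooth_on ?S (vf_rep A c (\<lambda>p. J (X p)))"
    by (rule smooth_on_cong[OF S, rotated])
      (use in_chart_image[OF c] coord_J[OF c] in \<open>auto simp: vf_rep_def\<close>)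
qed

end

section \<open>Pull-back to a submanifold\<close>

context complex_submanifold
begin

lemma F_rep_smooth:
  "b \<in> B \<Longrightarrow> c \<in> A \<Longrightarrow> smooth_on (snd b ` (fst b \<inter> F -` fst c)) (snd c \<circ> F \<circ> chart_inv b)"
  using F_hol unfolding hol_map_on_def by blast

lemma open_vimage_F: "open W \<Longrightarrow> open (F -` W)"
  using F_cont open_vimage by blast

text \<open>\<open>diff_map\<close> is defined through the chosen charts \<open>b0\<close> and
  \<open>c0\<close>. Both sides come from differentiating \<open>F\<close> read from
  \<open>b0\<close> to \<open>c\<close>, factored once through \<open>c0\<close> on the target and
  once through \<open>b\<close> on the source.\<close>

lemma coord_diff_map:
  assumes b: "b \<in> B" "q \<in> fst b" and c: "c \<in> A" "F q \<in> fst c"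
  shows "coord A c (F q) (diff_map B A F q z) = fd (snd c \<circ> F \<circ> chart_inv b) (snd b q) (coord B b q z)"
proof -
  define b0 where "b0 = chart_at B q"
  define c0 where "c0 = chart_at A (F q)"
  have b0: "b0 \<in> B" "q \<in> fst b0" unfolding b0_def by (rule chart_at_in[OF sub_atlas])+
  have c0: "c0 \<in> A" "F q \<in> fst c0" unfolding c0_def by (rule chart_at_in[OF ambient_atlas])+
  note inv_B = chart_inv_chart[OF sub_atlas] and inv_A = chart_inv_chart[OF ambient_atlas]
  have der: "((snd c' \<circ> F \<circ> chart_inv b') has_derivative fd (snd c' \<circ> F \<circ> chart_inv b') (snd b' q)) (at (snd b' q))"
    if "b' \<in> B" "q \<in> fst b'" "c' \<in> A" "F q \<in> fst c'" for b' c'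
    using smooth_on_has_derivative[OF F_rep_smooth[OF that(1,3)]] that by blast
  have S1: "open (snd b0 ` (fst b0 \<inter> F -` fst c0))" "snd b0 q \<in> snd b0 ` (fst b0 \<inter> F -` fst c0)"
    and S2: "open (snd b0 ` (fst b0 \<inter> fst b))" "snd b0 q \<in> snd b0 ` (fst b0 \<inter> fst b)"
    using open_chart_image[OF sub_atlas b0(1) open_vimage_F[OF open_chart_domain[OF ambient_atlas c0(1)]]]
      open_chart_image[OF sub_atlas b0(1) open_chart_domain[OF sub_atlas b(1)]] b0 b c0 by auto
  have "((\<lambda>x. (snd c \<circ> chart_inv c0) ((snd c0 \<circ> F \<circ> chart_inv b0) x)) has_derivative
      (\<lambda>z. fd (snd c \<circ> chart_inv c0) (snd c0 (F q)) (fd (snd c0 \<circ> F \<circ> chart_inv b0) (snd b0 q) z))) (at (snd b0 q))"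
  proof (rule has_derivative_compose[OF der[OF b0 c0]])
    show "((snd c \<circ> chart_inv c0) has_derivative fd (snd c \<circ> chart_inv c0) (snd c0 (F q)))
        (at ((snd c0 \<circ> F \<circ> chart_inv b0) (snd b0 q)))"
      using smooth_on_has_derivative[OF transition_smooth[OF ambient_atlas c0(1) c(1)], of "snd c0 (F q)"] b0 c c0
      by (simp add: inv_B)
  qed
  then have 1: "((snd c \<circ> F \<circ> chart_inv b0) has_derivative
      (\<lambda>z. fd (snd c \<circ> chart_inv c0) (snd c0 (F q)) (fd (snd c0 \<circ> F \<circ> chart_inv b0) (snd b0 q) z))) (at (snd b0 q))"
    by (rule has_derivative_transform_within_open[OF _ S1]) (auto simp: inv_A inv_B b0 c0)
  have "((\<lambda>x. (snd c \<circ> F \<circ> chart_inv b) ((snd b \<circ> chart_inv b0) x)) has_derivative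
      (\<lambda>z. fd (snd c \<circ> F \<circ> chart_inv b) (snd b q) (fd (snd b \<circ> chart_inv b0) (snd b0 q) z))) (at (snd b0 q))"
  proof (rule has_derivative_compose[where g = "snd c \<circ> F \<circ> chart_inv b"])
    show "((snd b \<circ> chart_inv b0) has_derivative fd (snd b \<circ> chart_inv b0) (snd b0 q)) (at (snd b0 q))"
      using smooth_on_has_derivative[OF transition_smooth[OF sub_atlas b0(1) b(1)], of "snd b0 q"] b0 b by blast
    show "((snd c \<circ> F \<circ> chart_inv b) has_derivative fd (snd c \<circ> F \<circ> chart_inv b) (snd b q))
        (at ((snd b \<circ> chart_inv b0) (snd b0 q)))"
      using der[OF b c] b0 by (simp add: inv_B)
  qed
  then have 2: "((snd c \<circ> F \<circ> chart_inv b0) has_derivative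
      (\<lambda>z. fd (snd c \<circ> F \<circ> chart_inv b) (snd b q) (fd (snd b \<circ> chart_inv b0) (snd b0 q) z))) (at (snd b0 q))"
    by (rule has_derivative_transform_within_open[OF _ S2]) (auto simp: inv_B b0 b)
  show ?thesis
    using fun_cong[OF has_derivative_unique[OF 1 2], of z]
    unfolding coord_def diff_map_def b0_def[symmetric] c0_def[symmetric] .
qed

lemma linear_diff_map: "linear (diff_map B A F q)"
  unfolding diff_map_def
  using smooth_on_linear_fd[OF F_rep_smooth[OF chart_at_in(1)[OF sub_atlas] chart_at_in(1)[OF ambient_atlas]]]
    chart_at_in(2)[OF sub_atlas] chart_at_in(2)[OF ambient_atlas] by blast

text \<open>As \<open>ext_d\<close> is tensorial, it may be evaluated on fields that are constant in a chart and agree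
  with the images of \<open>X\<close> and \<open>Y\<close> only at \<open>F q\<close>: no extension of \<open>X\<close> and \<open>Y\<close> to the ambient manifold
  is needed.\<close>

lemma pullback_lie_bracket:
  assumes \<theta>: "smooth_one_form A M \<theta>" and M: "open M"
    and W: "open W" "F ` W \<subseteq> M" and q: "q \<in> W"
    and X: "smooth_vf B W X" and Y: "smooth_vf B W Y"
    and zero: "\<And>q. q \<in> W \<Longrightarrow> \<theta> (F q) (diff_map B A F q (X q)) = 0"
      "\<And>q. q \<in> W \<Longrightarrow> \<theta> (F q) (diff_map B A F q (Y q)) = 0"
  shows "\<theta> (F q) (diff_map B A F q (lie_bracket B X Y q)) = - 2 *
    ext_d A \<theta> (chart_field A (chart_at A (F q)) (diff_map B A F q (X q)))
      (chart_field A (chart_at A (F q)) (diff_map B A F q (Y q))) (F q)"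
proof -
  define b where "b = chart_at B q"
  define c where "c = chart_at A (F q)"
  have b: "b \<in> B" "q \<in> fst b" unfolding b_def by (rule chart_at_in[OF sub_atlas])+
  have c: "c \<in> A" "F q \<in> fst c" unfolding c_def by (rule chart_at_in[OF ambient_atlas])+
  have c_field: "chart_field A c w (F q) = w" for w
    using chart_field_coord[OF ambient_atlas c, of w] coord_self[OF ambient_atlas, of "F q" w]
    unfolding c_def by simp
  let ?X = "chart_field A c (diff_map B A F q (X q))" and ?Y = "chart_field A c (diff_map B A F q (Y q))"
  define f where "f = snd c \<circ> F \<circ> chart_inv b"
  define S where "S = snd b ` (fst b \<inter> (F -` fst c \<inter> W))"
  define x where "x = snd b q"
  \<comment> \<open>The form \<open>\<theta>\<close> read in the chart \<open>c\<close>;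
    \<open>w\<close> is a vector of components in \<open>c\<close>.\<close>
  define \<alpha> where "\<alpha> z w = \<theta> (chart_inv c z) (chart_field A c w (chart_inv c z))" for z w
  have fx: "f x = snd c (F q)"
    unfolding f_def x_def using b by (simp add: chart_inv_chart[OF sub_atlas])
  have S: "open S" "x \<in> S"
    unfolding S_def x_def
    using open_chart_image[OF sub_atlas b(1) open_Int[OF open_vimage_F[OF open_chart_domain[OF ambient_atlas c(1)]] W(1)]]
      b c q by auto
  have f: "smooth_on S f"
    unfolding f_def S_def by (rule smooth_on_subset[OF F_rep_smooth[OF b(1) c(1)]]) auto
  have rep: "smooth_on S (vf_rep B b Z)" if "smooth_vf B W Z" for Z
    unfolding S_def by (rule smooth_on_subset[OF smooth_vf_rep[OF sub_atlas that b(1)]]) auto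
  have \<alpha>_F: "\<alpha> (snd c p) w = \<theta> p (chart_field A c w p)" if "p \<in> fst c" for p w
    using that c by (simp add: \<alpha>_def chart_inv_chart[OF ambient_atlas])
  have \<alpha>_f: "\<alpha> (f y) (fd f y (coord B b (chart_inv b y) z)) = \<theta> (F (chart_inv b y)) (diff_map B A F (chart_inv b y) z)"
    if y: "y \<in> S" for y z
  proof -
    define q' where "q' = chart_inv b y"
    have q': "q' \<in> fst b" "q' \<in> F -` fst c \<inter> W" "snd b q' = y"
      using in_chart_image[OF sub_atlas b(1) y[unfolded S_def]] unfolding q'_def by auto
    have "fd f y (coord B b q' z) = coord A c (F q') (diff_map B A F q' z)"
      using coord_diff_map[OF b(1) q'(1) c(1), of z] q' unfolding f_def by simp
    moreover have "f y = snd c (F q')" unfolding f_def q'_def by simp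
    ultimately show ?thesis
      using \<alpha>_F[of "F q'"] q' chart_field_coord[OF ambient_atlas c(1)] unfolding q'_def by auto
  qed
  have key: "\<alpha> (f x) (fd f x (bracket (vf_rep B b X) (vf_rep B b Y) x)) =
    fd (\<lambda>z. \<alpha> z (fd f x (vf_rep B b X x))) (f x) (fd f x (vf_rep B b Y x))
    - fd (\<lambda>z. \<alpha> z (fd f x (vf_rep B b Y x))) (f x) (fd f x (vf_rep B b X x))"
  proof (rule pullback_bracket[OF S f rep[OF X] rep[OF Y]])
    fix y assume y: "y \<in> S"
    note q' = in_chart_image[OF sub_atlas b(1) y[unfolded S_def]]
    have p: "F (chart_inv b y) \<in> fst c" "F (chart_inv b y) \<in> M" using q' W by auto
    have "linear (\<theta> (F (chart_inv b y)))" using \<theta> p unfolding smooth_one_form_def by blast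
    from linear_compose[OF linear_chart_field[OF ambient_atlas c(1) p(1)] this]
    moreover have "\<alpha> (f y) = (\<lambda>w. \<theta> (F (chart_inv b y)) (chart_field A c w (F (chart_inv b y))))"
      using \<alpha>_F[OF p(1)] by (simp add: f_def fun_eq_iff)
    ultimately show "linear (\<alpha> (f y))" by (simp add: o_def)
    show "\<alpha> (f y) (fd f y (vf_rep B b X y)) = 0" "\<alpha> (f y) (fd f y (vf_rep B b Y y)) = 0"
      using \<alpha>_f[OF y] zero q' by (auto simp: vf_rep_def)
  next
    fix w
    have "smooth_vf A (M \<inter> fst c) (chart_field A c w)"
      using smooth_vf_chart_field[OF ambient_atlas c(1)] M open_chart_domain[OF ambient_atlas c(1)] by blast
    then have "smooth_fun A (M \<inter> fst c) (\<lambda>p. \<theta> p (chart_field A c w p))"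
      using \<theta> M open_chart_domain[OF ambient_atlas c(1)] unfolding smooth_one_form_def by blast
    then have "smooth_on (snd c ` (fst c \<inter> (M \<inter> fst c))) ((\<lambda>p. \<theta> p (chart_field A c w p)) \<circ> chart_inv c)"
      using c unfolding smooth_fun_def by blast
    then have "((\<lambda>p. \<theta> p (chart_field A c w p)) \<circ> chart_inv c) differentiable (at (f x))"
      by (rule smooth_on_differentiable) (use fx c W q in auto)
    then show "(\<lambda>z. \<alpha> z w) differentiable (at (f x))" by (simp add: \<alpha>_def o_def)
  qed
  have inv_x: "chart_inv b x = q" unfolding x_def using b chart_inv_chart[OF sub_atlas] by blast
  have coord_b: "coord B b q z = z" for z unfolding b_def by (rule coord_self[OF sub_atlas])
  have fd_f: "fd f x z = diff_map B A F q z" for z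
    using coord_diff_map[OF b c, of z] coord_self[OF ambient_atlas, of "F q"] coord_b
    unfolding f_def x_def c_def by simp
  have "lie_bracket A ?X ?Y (F q) = bracket (vf_rep A c ?X) (vf_rep A c ?Y) (snd c (F q))"
    unfolding c_def by (rule lie_bracket_eq[OF ambient_atlas])
  \<comment> \<open>Both representations are constant near \<open>snd c (F q)\<close>, so their
    derivatives vanish and \<open>ext_d\<close> keeps only its two derivative terms.\<close>
  also have "\<dots> = 0"
  proof -
    have "fd (vf_rep A c (chart_field A c w)) (snd c (F q)) = fd (\<lambda>_. w) (snd c (F q))" for w
    proof (rule fd_cong(1)[symmetric])
      show "open (snd c ` (fst c \<inter> UNIV))" using open_chart_image[OF ambient_atlas c(1) open_UNIV] .
      show "w = vf_rep A c (chart_field A c w) y" if "y \<in> snd c ` (fst c \<inter> UNIV)" for y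
        using vf_rep_chart_field[OF ambient_atlas c(1), of y w] that by simp
    qed (use c in auto)
    then show ?thesis by (simp add: bracket_def)
  qed
  finally have "lie_bracket A ?X ?Y (F q) = 0" .
  moreover have "linear (\<theta> (F q))" using \<theta> q W unfolding smooth_one_form_def by blast
  ultimately have "2 * ext_d A \<theta> ?X ?Y (F q) =
    dir_deriv A (\<lambda>p. \<theta> p (?Y p)) (F q) (diff_map B A F q (X q))
    - dir_deriv A (\<lambda>p. \<theta> p (?X p)) (F q) (diff_map B A F q (Y q))"
    by (simp add: ext_d_def c_field linear_0)
  moreover have "dir_deriv A (\<lambda>p. \<theta> p (chart_field A c w p)) (F q) = fd (\<lambda>z. \<alpha> z w) (f x)" for w
    unfolding dir_deriv_def c_def[symmetric] fx by (simp add: \<alpha>_def o_def)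
  moreover have "\<alpha> (f x) (fd f x z) = \<theta> (F q) (diff_map B A F q z)" for z
    using \<alpha>_f[OF S(2), of z] unfolding inv_x coord_b .
  moreover have "bracket (vf_rep B b X) (vf_rep B b Y) x = lie_bracket B X Y q"
    unfolding b_def x_def by (rule lie_bracket_eq[OF sub_atlas, symmetric])
  moreover have "vf_rep B b Z x = Z q" for Z by (simp add: vf_rep_def inv_x coord_b)
  ultimately show ?thesis using key unfolding c_def[symmetric] by (simp add: fd_f)
qed

end

section \<open>The anti-invariant distribution\<close>

context semi_invariant_submanifold
begin

abbreviation dF :: "'q \<Rightarrow> complex ^ 'k \<Rightarrow> complex ^ 'n" where
  "dF \<equiv> diff_map B A F"

section \<open>The forms \<open>u\<close> and \<open>v\<close> and their structure equations along
  the submanifold\<close>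

lemma open_N: "i \<in> I \<Longrightarrow> open (N i)"
  using nbhd unfolding coordinate_nbhd_def complex_atlas_def by fastforce

lemma metric: "bilinear (g p)" "g p x y = g p y x" "x \<noteq> 0 \<Longrightarrow> g p x x > 0" "g p (J x) (J y) = g p x y"
  using hermitian unfolding hermitian_metric_def riemannian_metric_def by auto

text \<open>\<open>J\<close> is an isometry with square -1, which accounts for the sign in
  \<open>V i p = - J (U i p)\<close>.\<close>

lemma v_dual:
  assumes "i \<in> I" "p \<in> N i"
  shows "v i p x = g p (V i p) x"
proof -
  have "v i p x = g p (J (U i p)) (J (J x))"
    using v_eq[OF assms] U_dual[OF assms] metric(4) by simp
  also have "J (J x) = - x" by (simp add: J_def vec_eq_iff flip: mult.assoc)
  finally show ?thesis
    using V_eq[OF assms] bilinear_lneg[OF metric(1)] bilinear_rneg[OF metric(1)] by simp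
qed

lemma v_smooth:
  assumes i: "i \<in> I"
  shows "smooth_one_form A (N i) (v i)"
  unfolding smooth_one_form_def
proof (intro conjI ballI allI impI)
  fix p assume "p \<in> N i"
  then have "v i p = g p (V i p)" using v_dual[OF i] by blast
  then show "linear (v i p)" using metric(1) unfolding bilinear_def by simp
next
  fix W X assume W: "open W \<and> W \<subseteq> N i \<and> smooth_vf A W X"
  then have "smooth_vf A W (\<lambda>p. J (X p))" using smooth_vf_J[OF atlas] by blast
  then have u: "smooth_fun A W (\<lambda>p. u i p (J (X p)))"
    using u_smooth[OF i] W unfolding smooth_one_form_def by blast
  show "smooth_fun A W (\<lambda>p. v i p (X p))"
    unfolding smooth_fun_def
  proof
    fix c assume c: "c \<in> A"
    then have "smooth_on (snd c ` (fst c \<inter> W)) ((\<lambda>p. u i p (J (X p))) \<circ> chart_inv c)"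
      using u unfolding smooth_fun_def by blast
    then show "smooth_on (snd c ` (fst c \<inter> W)) ((\<lambda>p. v i p (X p)) \<circ> chart_inv c)"
    proof (rule smooth_on_cong[rotated 2])
      show "open (snd c ` (fst c \<inter> W))" using open_chart_image[OF atlas c] W by blast
      show "((\<lambda>p. u i p (J (X p))) \<circ> chart_inv c) x = ((\<lambda>p. v i p (X p)) \<circ> chart_inv c) x"
        if "x \<in> snd c ` (fst c \<inter> W)" for x
        using in_chart_image[OF atlas c that] v_eq[OF i] W by auto
    qed
  qed
qed

text \<open>Since \<open>u\<close> and \<open>v\<close> kill both fields, the wedge terms of the
  structure equations vanish and only the metric term survives, doubled by the convention for
  \<open>ext_d\<close>. Horizontality is required on all of \<open>W\<close> because it gets
  differentiated.\<close>

lemma horizontal_bracket: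
  assumes i: "i \<in> I" and W: "open W" "F ` W \<subseteq> N i" and q: "q \<in> W"
    and X: "smooth_vf B W X" and Y: "smooth_vf B W Y"
    and X0: "\<And>q. q \<in> W \<Longrightarrow> u i (F q) (dF q (X q)) = 0 \<and> v i (F q) (dF q (X q)) = 0"
    and Y0: "\<And>q. q \<in> W \<Longrightarrow> u i (F q) (dF q (Y q)) = 0 \<and> v i (F q) (dF q (Y q)) = 0"
  shows "u i (F q) (dF q (lie_bracket B X Y q)) = - 2 * g (F q) (dF q (X q)) (G i (F q) (dF q (Y q)))"
    "v i (F q) (dF q (lie_bracket B X Y q)) = - 2 * g (F q) (dF q (X q)) (H i (F q) (dF q (Y q)))"
proof -
  define c where "c = chart_at A (F q)"
  have c: "c \<in> A" "F q \<in> fst c" unfolding c_def by (rule chart_at_in[OF atlas])+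
  have c_field: "chart_field A c w (F q) = w" for w
    using chart_field_coord[OF atlas c, of w] coord_self[OF atlas, of "F q" w]
    unfolding c_def by simp
  let ?M = "N i \<inter> fst c"
  have M: "open ?M" using open_N[OF i] open_chart_domain[OF atlas c(1)] by blast
  have sm: "smooth_vf A ?M (chart_field A c w)" for w
    by (rule smooth_vf_chart_field[OF atlas c(1) M]) simp
  have qM: "F q \<in> ?M" using q W c by blast
  show "u i (F q) (dF q (lie_bracket B X Y q)) = - 2 * g (F q) (dF q (X q)) (G i (F q) (dF q (Y q)))"
    using pullback_lie_bracket[OF u_smooth[OF i] open_N[OF i] W q X Y] X0 Y0 q
      du[OF i M _ sm sm qM] unfolding c_def[symmetric] by (simp add: c_field wedge_def)
  show "v i (F q) (dF q (lie_bracket B X Y q)) = - 2 * g (F q) (dF q (X q)) (H i (F q) (dF q (Y q)))"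
    using pullback_lie_bracket[OF v_smooth[OF i] open_N[OF i] W q X Y] X0 Y0 q
      dv[OF i M _ sm sm qM] unfolding c_def[symmetric] by (simp add: c_field wedge_def)
qed

section \<open>Horizontality of the two distributions and of their brackets\<close>

lemma vert_UV:
  assumes "i \<in> I" "F q \<in> N i"
  obtains a b where "a \<in> vert i q" "b \<in> vert i q" "dF q a = U i (F q)" "dF q b = V i (F q)"
proof -
  obtain a b where ab: "U i (F q) = dF q a" "V i (F q) = dF q b"
    using U_tangent[OF assms] V_tangent[OF assms] by blast
  have "a \<in> vert i q" "b \<in> vert i q"
    using ab(1)[symmetric] ab(2)[symmetric] unfolding vert_eq[OF assms] by (auto intro: span_base)
  with ab show ?thesis using that by metis
qed

lemma D_horizontal:
  assumes "i \<in> I" "F q \<in> N i" "x \<in> D q"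
  shows "u i (F q) (dF q x) = 0" "v i (F q) (dF q x) = 0"
  using vert_UV[OF assms(1,2)] D_orth_vert[OF assms] metric(2) U_dual[OF assms(1,2)] v_dual[OF assms(1,2)]
  by metis+

lemma D_perp_horizontal:
  assumes "i \<in> I" "F q \<in> N i" "x \<in> D_perp q"
  shows "u i (F q) (dF q x) = 0" "v i (F q) (dF q x) = 0"
  using vert_UV[OF assms(1,2)] D_perp_orth_vert[OF assms] metric(2) U_dual[OF assms(1,2)] v_dual[OF assms(1,2)]
  by metis+

text \<open>\<open>G\<close> and \<open>H\<close> send \<open>Y\<close> to normal vectors, while
  \<open>X\<close> is tangent, so one anti-invariant factor suffices. The alternative for
  \<open>X\<close> serves only to make it horizontal; it covers the brackets of
  \<open>D_perp\<close> with itself and with \<open>D\<close>.\<close>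

lemma D_perp_bracket_horizontal:
  assumes i: "i \<in> I" and W: "open W" "F ` W \<subseteq> N i" and q: "q \<in> W"
    and X: "smooth_vf B W X" "\<And>q. q \<in> W \<Longrightarrow> X q \<in> D q \<or> X q \<in> D_perp q"
    and Y: "smooth_vf B W Y" "\<And>q. q \<in> W \<Longrightarrow> Y q \<in> D_perp q"
  shows "u i (F q) (dF q (lie_bracket B X Y q)) = 0 \<and> v i (F q) (dF q (lie_bracket B X Y q)) = 0"
proof -
  have N: "F q \<in> N i" if "q \<in> W" for q using W that by blast
  have X0: "u i (F q) (dF q (X q)) = 0 \<and> v i (F q) (dF q (X q)) = 0" if "q \<in> W" for q
    using D_horizontal[OF i N[OF that]] D_perp_horizontal[OF i N[OF that]] X(2)[OF that] by blast
  have Y0: "u i (F q) (dF q (Y q)) = 0 \<and> v i (F q) (dF q (Y q)) = 0" if "q \<in> W" for q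
    using D_perp_horizontal[OF i N[OF that]] Y(2)[OF that] by blast
  show ?thesis
    using horizontal_bracket[OF i W q X(1) Y(1) X0 Y0] metric(2)
      G_D_perp[OF i N[OF q] Y(2)[OF q]] H_D_perp[OF i N[OF q] Y(2)[OF q]] by simp
qed

lemma lie_bracket_anticomm: "lie_bracket C X Y q = - lie_bracket C Y X q"
  by (simp add: lie_bracket_def Let_def)

text \<open>The Jacobi identity needs fields rather than the single vector \<open>x\<close>, so it
  is applied to a local frame of \<open>D\<close>. The resulting equation is linear in the frame
  vector and extends to the span.\<close>

lemma D_perp_bracket_orth_D:
  assumes i: "i \<in> I" and q: "q \<in> W" "F q \<in> N i" and W: "open W"
    and K: "K \<in> sections B D_perp W" and L: "L \<in> sections B D_perp W" and x: "x \<in> D q"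
  shows "g (F q) (dF q (lie_bracket B K L q)) (dF q x) = 0"
proof -
  obtain W' r X where W': "open W'" "q \<in> W'" and X: "\<And>a. a < r \<Longrightarrow> smooth_vf B W' (X a)"
    and span: "\<And>q'. q' \<in> W' \<Longrightarrow> D q' = span ((\<lambda>a. X a q') ` {..<(r::nat)})"
    using D_smooth unfolding smooth_distribution_def by metis
  \<comment> \<open>The frame lives on \<open>W'\<close> and the structure equations hold over
    \<open>N i\<close>, so all fields are restricted to the common open set.\<close>
  let ?W = "W \<inter> F -` N i \<inter> W'"
  have oW: "open ?W" "F ` ?W \<subseteq> N i" "q \<in> ?W" using W W' q open_vimage_F[OF open_N[OF i]] by auto
  have K: "smooth_vf B ?W K" "\<And>q. q \<in> ?W \<Longrightarrow> K q \<in> D_perp q"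
    using K unfolding sections_def by (auto intro: smooth_vf_subset[OF sub_atlas])
  have L: "smooth_vf B ?W L" "\<And>q. q \<in> ?W \<Longrightarrow> L q \<in> D_perp q"
    using L unfolding sections_def by (auto intro: smooth_vf_subset[OF sub_atlas])
  let ?w = "dF q (lie_bracket B K L q)"
  have frame: "g (F q) ?w (G i (F q) (dF q (X a q))) = 0" if a: "a < r" for a
  proof -
    have Z: "smooth_vf B ?W (X a)" using smooth_vf_subset[OF sub_atlas X[OF a]] by blast
    have ZD: "X a q \<in> D q" if "q \<in> ?W" for q using span[of q] that a by (auto intro: span_base)
    note bracket = smooth_vf_lie_bracket[OF sub_atlas oW(1)]
    have Z0: "u i (F q) (dF q (X a q)) = 0 \<and> v i (F q) (dF q (X a q)) = 0" if "q \<in> ?W" for q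
      using D_horizontal[OF i _ ZD[OF that]] that by blast
    have P0: "u i (F q) (dF q (P q)) = 0 \<and> v i (F q) (dF q (P q)) = 0"
      if "\<And>q. q \<in> ?W \<Longrightarrow> P q \<in> D_perp q" "q \<in> ?W" for q P
      using D_perp_horizontal[OF i _ that(1)[OF that(2)]] that(2) by blast
    have KL: "u i (F q) (dF q (lie_bracket B K L q)) = 0 \<and> v i (F q) (dF q (lie_bracket B K L q)) = 0"
      if "q \<in> ?W" for q
      using D_perp_bracket_horizontal[OF i oW(1,2) that K(1) _ L] K(2) by blast
    have ZK: "u i (F q) (dF q (lie_bracket B (X a) K q)) = 0 \<and> v i (F q) (dF q (lie_bracket B (X a) K q)) = 0"
      if "q \<in> ?W" for q
      using D_perp_bracket_horizontal[OF i oW(1,2) that Z _ K] ZD by blast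
    have "u i (F q) (dF q (lie_bracket B (X a) L q)) = 0 \<and> v i (F q) (dF q (lie_bracket B (X a) L q)) = 0"
      if "q \<in> ?W" for q
      using D_perp_bracket_horizontal[OF i oW(1,2) that Z _ L] ZD by blast
    moreover have "u i (F q) (- w) = - u i (F q) w" "v i (F q) (- w) = - v i (F q) w" if "q \<in> ?W" for q w
      using U_dual[OF i] v_dual[OF i] bilinear_rneg[OF metric(1)] that by auto
    \<comment> \<open>\<open>D_perp_bracket_horizontal\<close> expects the anti-invariant field in
      second place; antisymmetry supplies the cyclic order used in the Jacobi identity.\<close>
    ultimately have LZ: "u i (F q) (dF q (lie_bracket B L (X a) q)) = 0 \<and> v i (F q) (dF q (lie_bracket B L (X a) q)) = 0"
      if "q \<in> ?W" for q
      using that unfolding lie_bracket_anticomm[of B L] linear_neg[OF linear_diff_map] by simp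
    let ?KLZ = "lie_bracket B (lie_bracket B K L) (X a) q"
    let ?LZK = "lie_bracket B (lie_bracket B L (X a)) K q"
    let ?ZKL = "lie_bracket B (lie_bracket B (X a) K) L q"
    have "u i (F q) (dF q ?KLZ) = - 2 * g (F q) ?w (G i (F q) (dF q (X a q)))"
      using horizontal_bracket(1)[OF i oW bracket[OF K(1) L(1)] Z KL Z0] .
    \<comment> \<open>Here the outer field is the anti-invariant \<open>K\<close>, so
      \<open>G\<close> sends it to a normal vector, which is orthogonal to the tangent inner
      bracket.\<close>
    moreover have "u i (F q) (dF q ?LZK) = 0"
      using horizontal_bracket(1)[OF i oW bracket[OF L(1) Z] K(1) LZ P0[OF K(2)]] metric(2)
        G_D_perp[OF i q(2) K(2)[OF oW(3)]] by simp
    moreover have "u i (F q) (dF q ?ZKL) = 0"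
      using horizontal_bracket(1)[OF i oW bracket[OF Z K(1)] L(1) ZK P0[OF L(2)]] metric(2)
        G_D_perp[OF i q(2) L(2)[OF oW(3)]] by simp
    moreover have "u i (F q) (dF q (?KLZ + ?LZK + ?ZKL)) = 0"
      using lie_bracket_jacobi[OF sub_atlas oW(1,3) K(1) L(1) Z] U_dual[OF i q(2)]
        linear_0[OF linear_diff_map] bilinear_rzero[OF metric(1)] by simp
    ultimately show ?thesis
      using U_dual[OF i q(2)] by (simp add: linear_add[OF linear_diff_map] bilinear_radd[OF metric(1)])
  qed
  have lin: "linear (\<lambda>x. g (F q) ?w (G i (F q) (dF q x)))"
  proof -
    have "linear (G i (F q))" using G_smooth[OF i] q unfolding smooth_endo_def by blast
    moreover have "linear (g (F q) ?w)" using metric(1) unfolding bilinear_def by blast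
    ultimately show ?thesis
      using linear_compose[OF linear_compose[OF linear_diff_map]] by (fastforce simp: o_def)
  qed
  obtain y where y: "y \<in> D q" "dF q x = G i (F q) (dF q y)" using G_D[OF i q(2)] x by blast
  have "g (F q) ?w (G i (F q) (dF q y)) = 0"
    by (rule linear_eq_0_on_span[OF lin _ y(1)[unfolded span[OF W'(2)]]]) (use frame in auto)
  with y show ?thesis by simp
qed

text \<open>At a point the bracket is split along the orthogonal decomposition. Pairing it with its
  own invariant and vertical components shows that both have length zero, which leaves the
  anti-invariant one.\<close>

lemma involutive_D_perp: "involutive B D_perp"
  unfolding involutive_def
proof (intro allI impI ballI)
  fix W K L assume W: "open W" and K: "K \<in> sections B D_perp W" and L: "L \<in> sections B D_perp W"
  have KL: "smooth_vf B W K" "smooth_vf B W L" using K L unfolding sections_def by auto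
  have "lie_bracket B K L q \<in> D_perp q" if q: "q \<in> W" for q
  proof -
    obtain i where i: "i \<in> I" "F q \<in> N i" using cover by blast
    let ?W = "W \<inter> F -` N i" and ?w = "lie_bracket B K L q"
    have uv: "u i (F q) (dF q ?w) = 0 \<and> v i (F q) (dF q ?w) = 0"
    proof (rule D_perp_bracket_horizontal[OF i(1), of ?W])
      show "open ?W" using W open_vimage_F[OF open_N[OF i(1)]] by blast
      show "smooth_vf B ?W K" "smooth_vf B ?W L" using KL smooth_vf_subset[OF sub_atlas] by auto
    qed (use K L q i in \<open>auto simp: sections_def\<close>)
    obtain x y z where xyz: "?w = x + y + z" "x \<in> D q" "y \<in> D_perp q" "z \<in> vert i q"
      using decomposition[OF i] by blast
    have lin: "linear (dF q)" by (rule linear_diff_map)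
    \<comment> \<open>Positivity of the metric gives \<open>dF q a = 0\<close>; the immersion
      property then gives \<open>a = 0\<close>.\<close>
    have nondeg: "a = 0" if "g (F q) (dF q a) (dF q a) = 0" for a
      using that metric(3)[of "dF q a" "F q"] F_immersion linear_0[OF lin] by (metis injD less_irrefl)
    have expand: "g (F q) (dF q ?w) a = g (F q) (dF q x) a + g (F q) (dF q y) a + g (F q) (dF q z) a" for a
      by (simp add: xyz(1) linear_add[OF lin] bilinear_ladd[OF metric(1)])
    have "g (F q) (dF q x) (dF q x) = 0"
      using D_perp_bracket_orth_D[OF i(1) q i(2) W K L xyz(2)] expand[of "dF q x"]
        D_orth_D_perp[OF xyz(2,3)] D_orth_vert[OF i xyz(2,4)] metric(2) by simp
    then have "x = 0" by (rule nondeg)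
    \<comment> \<open>A vertical vector is mapped into the span of \<open>U\<close> and
      \<open>V\<close>, so orthogonality to these two generators suffices.\<close>
    have "linear (g (F q) (dF q ?w))" using metric(1) unfolding bilinear_def by blast
    then have "g (F q) (dF q ?w) (dF q z) = 0"
    proof (rule linear_eq_0_on_span)
      show "dF q z \<in> span {U i (F q), V i (F q)}" using xyz(4) vert_eq[OF i] by blast
      show "g (F q) (dF q ?w) a = 0" if "a \<in> {U i (F q), V i (F q)}" for a
        using that uv U_dual[OF i] v_dual[OF i] metric(2) by auto
    qed
    then have "g (F q) (dF q z) (dF q z) = 0"
      using expand[of "dF q z"] D_orth_vert[OF i xyz(2,4)] D_perp_orth_vert[OF i xyz(3,4)] by simp
    then have "z = 0" by (rule nondeg)
    then show ?thesis using xyz \<open>x = 0\<close> by simp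
  qed
  then show "lie_bracket B K L \<in> sections B D_perp W"
    unfolding sections_def using smooth_vf_lie_bracket[OF sub_atlas W KL] by blast
qed

end

theorem theorem5p3:
  fixes A :: "('p::{t2_space,second_countable_topology}, 'n::finite) chart set"
    and B :: "('q::{t2_space,second_countable_topology}, 'k::finite) chart set"
    and F :: "'q \<Rightarrow> 'p"
    and m n :: nat
    and I :: "'i set"
  assumes "normal_complex_contact_metric_manifold A m I N \<omega> g u v U V G H nabla \<sigma>"
    and "semi_invariant_submanifold A m I N \<omega> g u v U V G H nabla \<sigma> B F n D D_perp vert"
  shows "involutive B D_perp"
  using semi_invariant_submanifold.involutive_D_perp[OF assms(2)] .

end
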